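(* For a group $G$ (not necessarily finitely generated), the following are equivalent: (1) $G$ is neither generalized dicyclic, nor abelian with an element of order greater than $2$; (2) $G$ is orientation-rigid; (3) for every generating set $S$ of $G$, the pair $(G,S^{\leq 3})$ is orientation-rigid; (3') there exists a generating set $S$ of $G$ such that the pair $(G,S^{\leq 3})$ is orientation-rigid; (4) for every generating set $S$ of $G$, the triple $(G,S,S^{\leq 3})$ is strongly orientation-rigid; (4') there exists a generating set $S$ of $G$ such that the triple $(G,S,S^{\leq 3})$ is strongly orientation-rigid.
   Context: Generating sets never contain the identity $1_G$. For a generating set $S$, $S^{\pm}=S\cup S^{-1}$, and $S^{\leq n}$ is the set of non-trivial elements of $G$ that are products of at most $n$ elements of $S^{\pm}$. $\mathrm{Cay}(G,S)$ is the simple undirected graph with vertex set $G$ and edge set $\{(g,h)\mid g^{-1}h\in S^\pm\}$. The ball $\mathrm{Ball}_{\mathrm{Cay}(G,S)}(1_G)$ is the induced subgraph on $\{1_G\}\cup S^\pm$. $\mathrm{Aut}(\mathrm{Cay}_{\mathrm{col}}(G,S))$ is the group of colour-preserving automorphisms: permutations $\varphi$ of $G$ with $\varphi(gs)\in\{\varphi(g)s,\varphi(g)s^{-1}\}$ for all $g\in G$, $s\in S^\pm$. If $B$ is a subgraph of $\mathrm{Cay}(G,S)$, a colour-preserving automorphism of $B$ is a permutation $\varphi$ of the vertex set of $B$ with $\varphi(gs)\in\{\varphi(g)s,\varphi(g)s^{-1}\}$ for all $g\in G$, $s\in S^\pm$ such that $(g,gs)$ is an edge of $B$. A pair $(G,S)$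 is orientation-rigid if $\mathrm{Aut}(\mathrm{Cay}_{\mathrm{col}}(G,S))$ acts freely and transitively on $G$ (equivalently, consists only of the left translations). $G$ is orientation-rigid if the pair $(G,G\setminus\{1_G\})$ is orientation-rigid. For generating sets $S\subseteq T$, the triple $(G,S,T)$ is strongly orientation-rigid if every colour-preserving automorphism of $\mathrm{Ball}_{\mathrm{Cay}(G,T)}(1_G)$ fixing $1_G$ fixes $\mathrm{Ball}_{\mathrm{Cay}(G,S)}(1_G)$ pointwise. A group $G$ is generalized dicyclic if it is non-abelian and has an abelian normal subgroup $A$ of index $2$ and an element $x\notin A$ of order $4$ with $xax^{-1}=a^{-1}$ for every $a\in A$. "Order greater than $2$" includes infinite order. *)

theory Defs
  imports "HOL-Algebra.Algebra" "Graph_Theory.Digraph_Component"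
begin

section \<open>Generating sets and products of bounded length\<close>

definition generating_set :: "('a, 'b) monoid_scheme \<Rightarrow> 'a set \<Rightarrow> bool"
  where "generating_set G S \<longleftrightarrow>
    S \<subseteq> carrier G - {\<one>\<^bsub>G\<^esub>} \<and> generate G S = carrier G"

definition symm :: "('a, 'b) monoid_scheme \<Rightarrow> 'a set \<Rightarrow> 'a set"
  where "symm G S = S \<union> set_inv\<^bsub>G\<^esub> S"

definition products_upto :: "('a, 'b) monoid_scheme \<Rightarrow> nat \<Rightarrow> 'a set \<Rightarrow> 'a set"
  where "products_upto G n S =
    {foldr (\<otimes>\<^bsub>G\<^esub>) ss \<one>\<^bsub>G\<^esub> | ss. set ss \<subseteq> symm G S \<and> length ss \<le> n} - {\<one>\<^bsub>G\<^esub>}"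


section \<open>Cayley graphs and colour-preserving automorphisms\<close>

text \<open>An undirected edge is represented by the two arcs in opposite directions;
  each arc is the pair of its end points.\<close>

definition Cay :: "('a, 'b) monoid_scheme \<Rightarrow> 'a set \<Rightarrow> ('a, 'a \<times> 'a) pre_digraph"
  where "Cay G S =
    \<lparr>verts = carrier G,
     arcs = {(g, h). g \<in> carrier G \<and> h \<in> carrier G \<and> inv\<^bsub>G\<^esub> g \<otimes>\<^bsub>G\<^esub> h \<in> symm G S},
     tail = fst,
     head = snd\<rparr>"

definition Cay_ball :: "('a, 'b) monoid_scheme \<Rightarrow> 'a set \<Rightarrow> ('a, 'a \<times> 'a) pre_digraph"
  where "Cay_ball G S = Cay G S \<restriction> ({\<one>\<^bsub>G\<^esub>} \<union> symm G S)"

definition colour_auts :: "('a, 'b) monoid_scheme \<Rightarrow> 'a set \<Rightarrow> ('a \<Rightarrow> 'a) set"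
  where "colour_auts G S =
    {\<phi> \<in> Bij (carrier G). \<forall>g \<in> carrier G. \<forall>s \<in> symm G S.
       \<phi> (g \<otimes>\<^bsub>G\<^esub> s) \<in> {\<phi> g \<otimes>\<^bsub>G\<^esub> s, \<phi> g \<otimes>\<^bsub>G\<^esub> inv\<^bsub>G\<^esub> s}}"

definition colour_aut_group :: "('a, 'b) monoid_scheme \<Rightarrow> 'a set \<Rightarrow> ('a \<Rightarrow> 'a) monoid"
  where "colour_aut_group G S = (BijGroup (carrier G))\<lparr>carrier := colour_auts G S\<rparr>"

definition subgraph_colour_auts ::
    "('a, 'b) monoid_scheme \<Rightarrow> 'a set \<Rightarrow> ('a, 'a \<times> 'a) pre_digraph \<Rightarrow> ('a \<Rightarrow> 'a) set"
  where "subgraph_colour_auts G S B =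
    {\<phi> \<in> Bij (verts B). \<forall>g \<in> carrier G. \<forall>s \<in> symm G S.
       (g, g \<otimes>\<^bsub>G\<^esub> s) \<in> arcs B \<longrightarrow>
       \<phi> (g \<otimes>\<^bsub>G\<^esub> s) \<in> {\<phi> g \<otimes>\<^bsub>G\<^esub> s, \<phi> g \<otimes>\<^bsub>G\<^esub> inv\<^bsub>G\<^esub> s}}"


section \<open>Orientation-rigidity\<close>

definition free_action :: "('g, 'b) monoid_scheme \<Rightarrow> 'a set \<Rightarrow> ('g \<Rightarrow> 'a \<Rightarrow> 'a) \<Rightarrow> bool"
  where "free_action H E \<psi> \<longleftrightarrow>
    group_action H E \<psi> \<and> (\<forall>x \<in> E. stabilizer H \<psi> x = {\<one>\<^bsub>H\<^esub>})"

definition orientation_rigid_pair :: "('a, 'b) monoid_scheme \<Rightarrow> 'a set \<Rightarrow> bool"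
  where "orientation_rigid_pair G S \<longleftrightarrow>
    free_action (colour_aut_group G S) (carrier G) (\<lambda>\<phi>. \<phi>) \<and>
    transitive_action (colour_aut_group G S) (carrier G) (\<lambda>\<phi>. \<phi>)"

definition orientation_rigid :: "('a, 'b) monoid_scheme \<Rightarrow> bool"
  where "orientation_rigid G \<longleftrightarrow> orientation_rigid_pair G (carrier G - {\<one>\<^bsub>G\<^esub>})"

definition strongly_orientation_rigid ::
    "('a, 'b) monoid_scheme \<Rightarrow> 'a set \<Rightarrow> 'a set \<Rightarrow> bool"
  where "strongly_orientation_rigid G S T \<longleftrightarrow>
    (\<forall>\<phi> \<in> subgraph_colour_auts G T (Cay_ball G T).
       \<phi> \<one>\<^bsub>G\<^esub> = \<one>\<^bsub>G\<^esub> \<longrightarrow> (\<forall>x \<in> verts (Cay_ball G S). \<phi> x = x))"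


section \<open>Generalized dicyclic groups\<close>

definition generalized_dicyclic :: "('a, 'b) monoid_scheme \<Rightarrow> bool"
  where "generalized_dicyclic G \<longleftrightarrow>
    group G \<and> \<not> comm_group G \<and>
    (\<exists>A. A \<lhd> G \<and> comm_group (G\<lparr>carrier := A\<rparr>) \<and> card (rcosets\<^bsub>G\<^esub> A) = 2 \<and>
      (\<exists>x \<in> carrier G - A. group.ord G x = 4 \<and>
        (\<forall>a \<in> A. x \<otimes>\<^bsub>G\<^esub> a \<otimes>\<^bsub>G\<^esub> inv\<^bsub>G\<^esub> x = inv\<^bsub>G\<^esub> a)))"

text \<open>The library's order function takes the value 0 on elements of infinite order.\<close>

definition order_gt_2 :: "('a, 'b) monoid_scheme \<Rightarrow> 'a \<Rightarrow> bool"
  where "order_gt_2 G x \<longleftrightarrow> group.ord G x = 0 \<or> group.ord G x > 2"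


section \<open>Consistency of the definitions\<close>

context group
begin

lemma symm_carrier: "S \<subseteq> carrier G \<Longrightarrow> symm G S \<subseteq> carrier G"
  by (auto simp: symm_def SET_INV_def)

lemma symm_inv: "S \<subseteq> carrier G \<Longrightarrow> s \<in> symm G S \<Longrightarrow> inv s \<in> symm G S"
  by (auto simp: symm_def SET_INV_def subset_iff)

lemma Cay_symmetric:
  assumes "S \<subseteq> carrier G" "(g, h) \<in> arcs (Cay G S)"
  shows "(h, g) \<in> arcs (Cay G S)"
  using assms symm_inv[OF assms(1), of "inv g \<otimes> h"] by (auto simp: Cay_def inv_mult_group)

lemma Cay_loopfree:
  assumes "S \<subseteq> carrier G - {\<one>}"
  shows "(g, g) \<notin> arcs (Cay G S)"
  using assms by (auto simp: Cay_def symm_def SET_INV_def) (metis DiffE insertI1 inv_eq_1_iff subset_iff)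

lemma colour_auts_eq_subgraph_colour_auts:
  assumes "S \<subseteq> carrier G"
  shows "colour_auts G S = subgraph_colour_auts G S (Cay G S)"
  using symm_carrier[OF assms]
  by (auto simp: colour_auts_def subgraph_colour_auts_def Cay_def subset_iff m_assoc[symmetric])

lemma subgroup_colour_auts:
  assumes S: "S \<subseteq> carrier G"
  shows "subgroup (colour_auts G S) (BijGroup (carrier G))"
proof -
  interpret B: group "BijGroup (carrier G)" by (rule group_BijGroup)
  note SC = symm_carrier[OF S]
  have cl: "\<phi> x \<in> carrier G" if "\<phi> \<in> Bij (carrier G)" "x \<in> carrier G" for \<phi> x
    using that Bij_imp_funcset by blast
  show ?thesis
  proof (rule B.subgroupI)
    show "colour_auts G S \<subseteq> carrier (BijGroup (carrier G))"
      by (auto simp: colour_auts_def BijGroup_def)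
    have "(\<lambda>x \<in> carrier G. x) \<in> colour_auts G S"
      using SC by (auto simp: colour_auts_def id_Bij)
    then show "colour_auts G S \<noteq> {}" by blast
  next
    fix \<phi> assume p: "\<phi> \<in> colour_auts G S"
    then have pB: "\<phi> \<in> Bij (carrier G)" by (simp add: colour_auts_def)
    define \<psi> where "\<psi> = (\<lambda>x \<in> carrier G. inv_into (carrier G) \<phi> x)"
    have inj: "inj_on \<phi> (carrier G)" and surj: "\<phi> ` carrier G = carrier G"
      using pB by (auto simp: Bij_def bij_betw_def)
    have l: "\<psi> (\<phi> x) = x" if "x \<in> carrier G" for x
      using that cl[OF pB] inj by (simp add: \<psi>_def)
    have r: "\<phi> (\<psi> x) = x" "\<psi> x \<in> carrier G" if "x \<in> carrier G" for x
      using that surj by (simp_all add: \<psi>_def f_inv_into_f inv_into_into)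
    have "\<psi> (h \<otimes> s) \<in> {\<psi> h \<otimes> s, \<psi> h \<otimes> inv s}"
      if h: "h \<in> carrier G" and s: "s \<in> symm G S" for h s
    proof -
      define g where "g = \<psi> h"
      have g: "g \<in> carrier G" "\<phi> g = h" using r h by (auto simp: g_def)
      have sc: "s \<in> carrier G" using s SC by blast
      have 1: "\<phi> (g \<otimes> s) \<in> {h \<otimes> s, h \<otimes> inv s}"
        using p g s by (auto simp: colour_auts_def)
      have 2: "\<phi> (g \<otimes> inv s) \<in> {h \<otimes> inv s, h \<otimes> s}"
        using p g symm_inv[OF S s] sc by (fastforce simp: colour_auts_def)
      have "h \<otimes> s = \<phi> (g \<otimes> s) \<or> h \<otimes> s = \<phi> (g \<otimes> inv s)"
      proof (rule ccontr)
        assume "\<not> ?thesis"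
        then have "\<phi> (g \<otimes> s) = h \<otimes> inv s" "\<phi> (g \<otimes> s) = \<phi> (g \<otimes> inv s)" "h \<otimes> s \<noteq> h \<otimes> inv s"
          using 1 2 by auto
        then show False using inj_onD[OF inj, of "g \<otimes> s" "g \<otimes> inv s"] g h sc by simp
      qed
      then show ?thesis using l g sc by (auto simp: g_def)
    qed
    then have "\<psi> \<in> colour_auts G S"
      using restrict_inv_into_Bij[OF pB] by (auto simp: colour_auts_def \<psi>_def)
    then show "inv\<^bsub>BijGroup (carrier G)\<^esub> \<phi> \<in> colour_auts G S"
      by (simp add: inv_BijGroup[OF pB] \<psi>_def)
  next
    fix \<phi> \<psi> assume p: "\<phi> \<in> colour_auts G S" and q: "\<psi> \<in> colour_auts G S"
    then have B: "\<phi> \<in> Bij (carrier G)" "\<psi> \<in> Bij (carrier G)" by (simp_all add: colour_auts_def)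
    have "\<phi> (\<psi> (g \<otimes> s)) \<in> {\<phi> (\<psi> g) \<otimes> s, \<phi> (\<psi> g) \<otimes> inv s}"
      if g: "g \<in> carrier G" and s: "s \<in> symm G S" for g s
    proof -
      have sc: "s \<in> carrier G" using s SC by blast
      have "\<psi> (g \<otimes> s) \<in> {\<psi> g \<otimes> s, \<psi> g \<otimes> inv s}"
        using q g s by (auto simp: colour_auts_def)
      moreover have "\<phi> (\<psi> g \<otimes> s) \<in> {\<phi> (\<psi> g) \<otimes> s, \<phi> (\<psi> g) \<otimes> inv s}"
        using p cl[OF B(2) g] s by (auto simp: colour_auts_def)
      moreover have "\<phi> (\<psi> g \<otimes> inv s) \<in> {\<phi> (\<psi> g) \<otimes> inv s, \<phi> (\<psi> g) \<otimes> s}"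
        using p cl[OF B(2) g] symm_inv[OF S s] sc by (fastforce simp: colour_auts_def)
      ultimately show ?thesis by auto
    qed
    moreover have "g \<otimes> s \<in> carrier G" if "g \<in> carrier G" "s \<in> symm G S" for g s
      using that SC by blast
    ultimately have "compose (carrier G) \<phi> \<psi> \<in> colour_auts G S"
      using compose_Bij[OF B] by (simp add: colour_auts_def compose_def)
    then show "\<phi> \<otimes>\<^bsub>BijGroup (carrier G)\<^esub> \<psi> \<in> colour_auts G S"
      using B by (simp add: BijGroup_def)
  qed
qed

lemma group_action_colour_aut_group:
  assumes "S \<subseteq> carrier G"
  shows "group_action (colour_aut_group G S) (carrier G) (\<lambda>\<phi>. \<phi>)"
proof -
  interpret B: group "BijGroup (carrier G)" by (rule group_BijGroup)
  interpret H: subgroup "colour_auts G S" "BijGroup (carrier G)"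
    by (rule subgroup_colour_auts[OF assms])
  have "group (colour_aut_group G S)"
    unfolding colour_aut_group_def by (rule H.subgroup_is_group[OF B.is_group])
  moreover have "(\<lambda>\<phi>. \<phi>) \<in> hom (colour_aut_group G S) (BijGroup (carrier G))"
    using H.subset by (auto simp: hom_def colour_aut_group_def)
  ultimately show ?thesis
    by (simp add: group_action_def group_hom_def group_hom_axioms_def B.is_group)
qed

lemma generating_set_nontrivial: "generating_set G (carrier G - {\<one>})"
proof -
  have "x \<in> generate G (carrier G - {\<one>})" if "x \<in> carrier G" for x
    using that by (cases "x = \<one>") (auto intro: generate.one generate.incl)
  then show ?thesis
    using generate_incl[of "carrier G - {\<one>}"] by (auto simp: generating_set_def)
qed

lemma generating_set_products_upto:
  assumes gS: "generating_set G S" and n: "1 \<le> n"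
  shows "S \<subseteq> products_upto G n S" "generating_set G (products_upto G n S)"
proof -
  have S: "S \<subseteq> carrier G" "\<one> \<notin> S" and g: "generate G S = carrier G"
    using gS by (auto simp: generating_set_def)
  show sub: "S \<subseteq> products_upto G n S"
  proof
    fix s assume s: "s \<in> S"
    have "s = foldr (\<otimes>) [s] \<one> \<and> set [s] \<subseteq> symm G S \<and> length [s] \<le> n"
      using s S n by (auto simp: symm_def)
    moreover have "s \<noteq> \<one>" using s S by blast
    ultimately show "s \<in> products_upto G n S"
      unfolding products_upto_def by blast
  qed
  have "foldr (\<otimes>) ss \<one> \<in> carrier G" if "set ss \<subseteq> symm G S" for ss
    using that symm_carrier[OF S(1)] by (induction ss) auto
  then have P: "products_upto G n S \<subseteq> carrier G - {\<one>}"
    by (auto simp: products_upto_def)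
  then have "generate G (products_upto G n S) = carrier G"
    using mono_generate[OF sub] generate_incl[of "products_upto G n S"] g by auto
  with P show "generating_set G (products_upto G n S)"
    by (simp add: generating_set_def)
qed

end

end

(* Only "(1) implies (4)" needs an idea. Let \<phi> be a colour-preserving automorphism of the ball,
   taken with respect to the words of length at most 3, that fixes the identity; it sends every g
   in the ball to g or its inverse. Comparing the possible images of u, v and u v shows that an
   element moved by \<phi> inverts every fixed element v, and that two noncommuting moved generators
   have the same square, of order 2. If \<phi> moves a generator f0 and G is not abelian, then all
   moved generators have the same square, of order 2. Either the fixed generators and the products
   f0 f, with f a moved generator, commute pairwise and generate an abelian subgroup of index 2
   inverted by f0; or two generators i, j generate a quaternion group, and words of length 3 force
   every generator to be an element of this group times a central element of order at most 2. In
   both cases G is generalized dicyclic.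
   Conversely, inversion (abelian case) and the map that is the identity on A and the inversion
   outside A (generalized dicyclic case) preserve colours for every generating set. *)
theory Submission
  imports Defs
begin

section \<open>Commuting and inverting elements\<close>

context group
begin

text \<open>Commuting and inverting behave like the two signs of an action by conjugation: signs
  multiply along a product, and both signs hold at once only on an element of order at most 2. Most
  contradictions compute the sign of a product of two generators on a third one twice: from the two
  factors, and from the fact that the product itself is moved and so inverts fixed elements. The
  second computation needs the product of all three generators to be a vertex of the ball, which is
  where the length 3 comes from. The quaternion case has two forms, since the two generators may
  both be moved or both be fixed; in either form their product is moved. Between the conditions, one
  generating set is enough at each step: strong rigidity for \<open>S\<close> gives rigidity for the
  same \<open>S\<close>, because an automorphism of the whole graph can be re-based at any vertex by
  left translations; and the maps used when (1) fails refute rigidity for every set of colours at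
  once. This is why the universal and the existential versions coincide.\<close>

definition commutes :: "'a \<Rightarrow> 'a \<Rightarrow> bool"
  where "commutes x y \<longleftrightarrow> x \<otimes> y = y \<otimes> x"

text \<open>This is conjugation of \<open>y\<close> by \<open>x\<close> to its inverse, cleared of
  \<open>inv x\<close>. It then has the same shape as \<open>commutes\<close>, and both are used to
  push \<open>x\<close> past \<open>y\<close>.\<close>

definition inverts :: "'a \<Rightarrow> 'a \<Rightarrow> bool"
  where "inverts x y \<longleftrightarrow> x \<otimes> y = inv y \<otimes> x"

lemma inv_cancel_left [simp]:
  "\<lbrakk>x \<in> carrier G; y \<in> carrier G\<rbrakk> \<Longrightarrow> inv x \<otimes> (x \<otimes> y) = y"
  "\<lbrakk>x \<in> carrier G; y \<in> carrier G\<rbrakk> \<Longrightarrow> x \<otimes> (inv x \<otimes> y) = y"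
  by (simp_all add: m_assoc[symmetric])

lemma commutes_sym: "commutes x y \<longleftrightarrow> commutes y x"
  by (auto simp: commutes_def)

lemma commutes_refl [simp]: "commutes x x"
  by (simp add: commutes_def)

lemma commutes_one [simp]: "x \<in> carrier G \<Longrightarrow> commutes \<one> x" "x \<in> carrier G \<Longrightarrow> commutes x \<one>"
  by (simp_all add: commutes_def)

lemma commutes_mult_left:
  "\<lbrakk>commutes x t; commutes y t; x \<in> carrier G; y \<in> carrier G; t \<in> carrier G\<rbrakk> \<Longrightarrow> commutes (x \<otimes> y) t"
  unfolding commutes_def by (metis m_assoc)

lemma commutes_inv_right [simp]:
  assumes "x \<in> carrier G" "y \<in> carrier G"
  shows "commutes x (inv y) \<longleftrightarrow> commutes x y"
  using assms unfolding commutes_def by (metis inv_closed inv_solve_left inv_solve_right m_assoc m_closed)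

lemma commutes_inv_left [simp]:
  assumes "x \<in> carrier G" "y \<in> carrier G"
  shows "commutes (inv x) y \<longleftrightarrow> commutes x y"
  using assms commutes_inv_right commutes_sym by metis

lemma inverts_iff:
  assumes "u \<in> carrier G" "v \<in> carrier G"
  shows "inverts u v \<longleftrightarrow> u \<otimes> inv v = v \<otimes> u"
  using assms unfolding inverts_def
  by (metis inv_closed inv_solve_left inv_solve_right m_assoc m_closed)

lemma inverts_inv_right [simp]:
  assumes "u \<in> carrier G" "v \<in> carrier G"
  shows "inverts u (inv v) \<longleftrightarrow> inverts u v"
  using assms inverts_iff unfolding inverts_def by simp

lemma inverts_inv_left [simp]:
  assumes "u \<in> carrier G" "v \<in> carrier G"
  shows "inverts (inv u) v \<longleftrightarrow> inverts u v"
proof -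
  have "inv (inv v \<otimes> u) = inv u \<otimes> v" "inv (u \<otimes> v) = inv v \<otimes> inv u"
    using assms by (simp_all add: inv_mult_group)
  then show ?thesis
    using assms unfolding inverts_def by (metis inv_closed inv_inv m_closed)
qed

text \<open>Conjugation by \<open>u \<otimes> w\<close> is the composition of the two conjugations,
  so the signs multiply.\<close>

lemma inverts_mult_left:
  assumes c: "u \<in> carrier G" "w \<in> carrier G" "v \<in> carrier G"
  shows "inverts u v \<Longrightarrow> inverts w v \<Longrightarrow> commutes (u \<otimes> w) v"
    and "commutes u v \<Longrightarrow> inverts w v \<Longrightarrow> inverts (u \<otimes> w) v"
    and "inverts u v \<Longrightarrow> commutes w v \<Longrightarrow> inverts (u \<otimes> w) v"
proof -
  \<comment> \<open>Here \<open>a\<close> is the conjugate of \<open>v\<close> by \<open>w\<close>,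
    and \<open>b\<close> that of \<open>a\<close> by \<open>u\<close>; each is \<open>v\<close> or
    its inverse below.\<close>
  have r: "(u \<otimes> w) \<otimes> v = b \<otimes> (u \<otimes> w)"
    if "w \<otimes> v = a \<otimes> w" "u \<otimes> a = b \<otimes> u" "a \<in> carrier G" "b \<in> carrier G" for a b
    using that c by (metis m_assoc)
  show "commutes (u \<otimes> w) v" if "inverts u v" "inverts w v"
    using r[of "inv v" v] that c inverts_iff[of u v] by (simp add: inverts_def commutes_def)
  show "inverts (u \<otimes> w) v" if "commutes u v" "inverts w v"
    using r[of "inv v" "inv v"] that c commutes_inv_right[of u v]
    unfolding inverts_def commutes_def by simp
  show "inverts (u \<otimes> w) v" if "inverts u v" "commutes w v"
    using r[of v "inv v"] that c unfolding inverts_def commutes_def by simp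
qed

lemma commutes_mult_leftI:
  assumes "u \<in> carrier G" "w \<in> carrier G" "v \<in> carrier G"
    and "commutes u v \<and> commutes w v \<or> inverts u v \<and> inverts w v"
  shows "commutes (u \<otimes> w) v"
  using assms commutes_mult_left inverts_mult_left(1) by blast

text \<open>If \<open>u\<close> inverts \<open>v\<close>, commuting means that \<open>v\<close> is
  its own inverse. A conflict of signs thus always ends in an involution or the identity.\<close>

lemma inverts_commutes_iff:
  assumes "u \<in> carrier G" "v \<in> carrier G" "inverts u v"
  shows "commutes u v \<longleftrightarrow> v \<otimes> v = \<one>"
proof -
  have "commutes u v \<longleftrightarrow> inv v = v"
    using assms by (simp add: commutes_def inverts_def)
  also have "\<dots> \<longleftrightarrow> v \<otimes> v = \<one>"
    using assms by (metis inv_equality l_inv)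
  finally show ?thesis .
qed

text \<open>Conjugation by \<open>u\<close> sends \<open>v \<otimes> w\<close> to
  \<open>inv v \<otimes> inv w\<close> and also to \<open>inv w \<otimes> inv v\<close>.\<close>

lemma commutes_if_inverts_mult:
  assumes "u \<in> carrier G" "v \<in> carrier G" "w \<in> carrier G"
    and "inverts u v" "inverts u w" "inverts u (v \<otimes> w)"
  shows "commutes v w"
proof -
  have "inv w \<otimes> (inv v \<otimes> u) = inv v \<otimes> (inv w \<otimes> u)"
    using assms unfolding inverts_def by (metis inv_closed inv_mult_group m_assoc)
  then have "commutes (inv w) (inv v)"
    using assms unfolding commutes_def by (metis inv_closed m_assoc m_closed r_cancel)
  then show ?thesis using assms by (simp add: commutes_sym)
qed

text \<open>Equal squares may be exchanged, which turns \<open>inv u \<otimes> v\<close> into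
  \<open>u \<otimes> inv v\<close>. Inverting is therefore mutual among elements with the same
  square, as in the quaternion group.\<close>

lemma inverts_flip:
  assumes "u \<in> carrier G" "v \<in> carrier G" "inverts u v" "u \<otimes> u = v \<otimes> v"
  shows "inverts v u"
proof -
  have "inv u \<otimes> v = inv u \<otimes> (v \<otimes> v) \<otimes> inv v" using assms by (simp add: m_assoc)
  also have "\<dots> = u \<otimes> inv v" using assms(1,2) by (simp flip: assms(4))
  also have "\<dots> = v \<otimes> u" using assms by (simp add: inverts_iff)
  finally show ?thesis by (simp add: inverts_def)
qed

lemma square_if_inverts:
  assumes "u \<in> carrier G" "v \<in> carrier G" "inverts u v"
  shows "(u \<otimes> v) \<otimes> (u \<otimes> v) = u \<otimes> u"
proof -
  have "v \<otimes> (u \<otimes> v) = u" using assms by (simp add: inverts_def)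
  then show ?thesis using assms by (simp add: m_assoc)
qed

lemma square_if_commutes:
  assumes "u \<in> carrier G" "v \<in> carrier G" "commutes u v"
  shows "(u \<otimes> v) \<otimes> (u \<otimes> v) = (u \<otimes> u) \<otimes> (v \<otimes> v)"
  using assms unfolding commutes_def by (metis m_assoc m_closed)

lemma square_one_iff: "x \<in> carrier G \<Longrightarrow> x \<otimes> x = \<one> \<longleftrightarrow> inv x = x"
  by (metis inv_equality l_inv)

text \<open>The hypothesis is the equation that remains when \<open>u\<close> is moved and
  \<open>u \<otimes> v\<close> is fixed.\<close>

lemma square_eq_inv_square:
  assumes "u \<in> carrier G" "v \<in> carrier G" "u \<otimes> v = inv u \<otimes> inv v"
  shows "u \<otimes> u = inv (v \<otimes> v)"
proof -
  have "inv v = u \<otimes> u \<otimes> v" using assms by (simp add: m_assoc)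
  then show ?thesis
    using assms inv_solve_right[of "u \<otimes> u" "inv v" v] by (simp add: inv_mult_group)
qed


section \<open>Criteria for being generalized dicyclic\<close>

lemma generate_commutes:
  assumes "\<And>s. s \<in> S \<Longrightarrow> commutes g s" "S \<subseteq> carrier G" "g \<in> carrier G" "h \<in> generate G S"
  shows "commutes g h"
  using assms(4)
proof (induction rule: generate.induct)
  case (eng h1 h2)
  then show ?case
    using commutes_mult_left[of h1 g h2] generate_in_carrier[OF assms(2)] assms(3)
    by (simp add: commutes_sym)
qed (use assms in auto)

lemma ord_eq_4:
  assumes "x \<in> carrier G" "x \<otimes> x \<noteq> \<one>" "(x \<otimes> x) \<otimes> (x \<otimes> x) = \<one>"
  shows "ord x = 4"
proof -
  have "x [^] (4::nat) = \<one>"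
    using assms by (simp add: numeral_eq_Suc m_assoc)
  then have "ord x dvd 4" using assms(1) by (simp add: pow_eq_id)
  then have "ord x \<in> {1, 2, 4}"
  proof -
    assume d: "ord x dvd 4"
    then have "ord x \<le> 4" "ord x \<noteq> 3"
      by (auto dest: dvd_imp_le)
    moreover from d have "ord x \<noteq> 0" by (metis dvd_0_left_iff zero_neq_numeral)
    ultimately show ?thesis by auto
  qed
  moreover have "\<not> ord x dvd 2"
    using assms pow_eq_id[of x 2] by (simp add: numeral_eq_Suc)
  ultimately show ?thesis by auto
qed

text \<open>The abelian subgroup is \<open>generate G B\<close>. Elements that lie in it, or do so
  after multiplication by \<open>x\<close>, are closed under products and inverses, because
  \<open>x\<close> inverts the subgroup and \<open>x \<otimes> x\<close> lies in it; hence they are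
  all of \<open>G\<close>. If \<open>x\<close> belonged to the subgroup, \<open>G\<close> would be
  abelian.\<close>

lemma generalized_dicyclicI:
  assumes B: "B \<subseteq> carrier G" "\<And>b c. b \<in> B \<Longrightarrow> c \<in> B \<Longrightarrow> commutes b c"
    and x: "x \<in> carrier G" "\<And>b. b \<in> B \<Longrightarrow> inverts x b"
      "x \<otimes> x \<noteq> \<one>" "(x \<otimes> x) \<otimes> (x \<otimes> x) = \<one>" "x \<otimes> x \<in> generate G B"
    and S: "S \<subseteq> carrier G" "generate G S = carrier G"
      "\<And>s. s \<in> S \<Longrightarrow> s \<in> generate G B \<or> s \<otimes> x \<in> generate G B"
    and "\<not> comm_group G"
  shows "generalized_dicyclic G"
proof -
  define A where "A = generate G B"
  have sub: "subgroup A G" unfolding A_def by (rule generate_is_subgroup[OF B(1)])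
  interpret A: subgroup A G by (rule sub)
  note [simp] = A.mem_carrier x(1) and xx = x(5)[folded A_def]
  have comm1: "commutes a b" if "a \<in> A" "b \<in> B" for a b
    using that B generate_commutes[of B b a] unfolding A_def by (metis commutes_sym subset_iff)
  have comm: "commutes a a'" if "a \<in> A" "a' \<in> A" for a a'
    using that comm1 generate_commutes[of B a a'] B(1) unfolding A_def
    by (meson generate_in_carrier)
  have xinv: "inverts x a" if "a \<in> A" for a
    using that unfolding A_def
  proof (induction rule: generate.induct)
    case one show ?case by (simp add: inverts_def)
  next
    case (incl h) then show ?case using x by simp
  next
    case (inv h) then show ?case using x B by auto
  next
    case (eng h k)
    then have h: "h \<in> A" "k \<in> A" by (simp_all add: A_def)
    then have [simp]: "h \<in> carrier G" "k \<in> carrier G" by simp_all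
    have "x \<otimes> (h \<otimes> k) = inv h \<otimes> (x \<otimes> k)"
      using eng.IH(1) by (simp add: inverts_def flip: m_assoc)
    also have "\<dots> = inv h \<otimes> inv k \<otimes> x"
      using eng.IH by (simp add: inverts_def m_assoc)
    also have "inv h \<otimes> inv k = inv (h \<otimes> k)"
      using comm[OF h] by (simp add: commutes_def inv_mult_group)
    finally show ?case by (simp add: inverts_def)
  qed
  have conj: "inv x \<otimes> (a \<otimes> y) = inv a \<otimes> (inv x \<otimes> y)" if "a \<in> A" "y \<in> carrier G" for a y
    using xinv[OF that(1)] that inverts_inv_left[of x a] unfolding inverts_def
    by (simp flip: m_assoc)
  have coset: "g \<in> A \<or> g \<otimes> x \<in> A" if "g \<in> carrier G" for g
  proof -
    have dec: "\<exists>a \<in> A. g = a \<otimes> inv x" if "g \<otimes> x \<in> A" "g \<in> carrier G" for g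
      using that by (intro bexI[of _ "g \<otimes> x"]) (simp_all add: m_assoc)
    have ixx: "inv x \<otimes> inv x \<in> A"
      using A.m_inv_closed[OF xx] by (simp add: inv_mult_group)
    have "g \<in> generate G S" using that S by simp
    then show ?thesis
    proof (induction rule: generate.induct)
      case (incl s) then show ?case using S by (simp add: A_def)
    next
      case (inv s)
      then have s: "s \<in> carrier G" "s \<in> A \<or> s \<otimes> x \<in> A" using S by (auto simp: A_def)
      show ?case
      proof (cases "s \<in> A")
        case False
        then obtain a where a: "a \<in> A" "s = a \<otimes> inv x" using dec s by blast
        have "inv s \<otimes> x = a \<otimes> (x \<otimes> x)"
          using a xinv[OF A.m_inv_closed[OF a(1)]]
          by (simp add: inv_mult_group inverts_def flip: m_assoc)
        then show ?thesis using a xx by simp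
      qed simp
    next
      case (eng g h)
      then have gh: "g \<in> carrier G" "h \<in> carrier G" using generate_in_carrier S(1) by blast+
      consider "g \<in> A" "h \<in> A" | "g \<in> A" "h \<otimes> x \<in> A" | "g \<otimes> x \<in> A" "h \<in> A"
        | "g \<otimes> x \<in> A" "h \<otimes> x \<in> A"
        using eng.IH by blast
      then show ?case
      proof cases
        case 1 then show ?thesis by simp
      next
        case 2
        then have "g \<otimes> (h \<otimes> x) \<in> A" by blast
        then show ?thesis using gh by (simp add: m_assoc)
      next
        case 3
        then obtain a where a: "a \<in> A" "g = a \<otimes> inv x" using dec gh by blast
        have "g \<otimes> h \<otimes> x = a \<otimes> inv h"
          using a 3 conj[of h x] by (simp add: m_assoc)
        then show ?thesis using a 3 by simp
      next
        case 4
        then obtain a b where a: "a \<in> A" "g = a \<otimes> inv x" and b: "b \<in> A" "h = b \<otimes> inv x"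
          using dec gh by meson
        have "g \<otimes> h = a \<otimes> (inv b \<otimes> (inv x \<otimes> inv x))"
          using a b conj[of b "inv x"] by (simp add: m_assoc)
        then show ?thesis using a b ixx by simp
      qed
    qed (simp add: A.one_closed)
  qed
  have xnA: "x \<notin> A"
  proof
    assume xA: "x \<in> A"
    have "g \<in> A" if "g \<in> carrier G" for g
      using coset[OF that]
    proof
      assume "g \<otimes> x \<in> A"
      then have "g \<otimes> x \<otimes> inv x \<in> A" using xA by blast
      then show ?thesis using that by (simp add: m_assoc)
    qed
    then have "comm_group G"
      using comm by (intro group_comm_groupI) (simp add: commutes_def)
    then show False using assms by blast
  qed
  have "A \<lhd> G"
  proof (rule normal_invI[OF sub])
    fix g h assume g: "g \<in> carrier G" and h: "h \<in> A"
    show "g \<otimes> h \<otimes> inv g \<in> A"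
    proof (cases "g \<in> A")
      case False
      \<comment> \<open>Outside \<open>A\<close>, the element \<open>g\<close> is
        \<open>a \<otimes> inv x\<close> with \<open>a\<close> commuting with \<open>A\<close>, so
        it inverts \<open>A\<close> just as \<open>x\<close> does.\<close>
      define a where "a = g \<otimes> x"
      have a: "a \<in> A" "g = a \<otimes> inv x" using coset[OF g] False g by (simp_all add: a_def m_assoc)
      have "g \<otimes> h = a \<otimes> inv h \<otimes> inv x"
        using a h xinv[OF h] inverts_inv_left[of x h] by (simp add: inverts_def m_assoc)
      also have "a \<otimes> inv h = inv h \<otimes> a" using comm[of a "inv h"] a h by (simp add: commutes_def)
      finally have "g \<otimes> h = inv h \<otimes> g" using a h by (simp add: m_assoc)
      then show ?thesis using g h by (simp add: m_assoc)
    qed (use h in simp)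
  qed
  moreover have "comm_group (G\<lparr>carrier := A\<rparr>)"
    using comm by (intro group.group_comm_groupI subgroup_imp_group[OF sub]) (simp add: commutes_def)
  moreover have "rcosets A = {A, A #> x}"
  proof -
    have "A #> g = A #> x" if "g \<in> carrier G" "g \<otimes> x \<in> A" for g
    proof -
      have "x \<otimes> inv g = (x \<otimes> x) \<otimes> inv (g \<otimes> x)"
        using that by (simp add: inv_mult_group m_assoc)
      then have "x \<otimes> inv g \<in> A" using that xx by (metis A.m_closed A.m_inv_closed)
      moreover have "x = x \<otimes> inv g \<otimes> g" using that by (simp add: m_assoc)
      ultimately have "x \<in> A #> g" unfolding r_coset_def by blast
      then show ?thesis using repr_independence[of x A g] sub that by blast
    qed
    then have "A #> g \<in> {A, A #> x}" if "g \<in> carrier G" for g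
      using coset[OF that] coset_join2[OF that sub] that by blast
    moreover have "A = A #> \<one>" using sub A.subset by (simp add: coset_mult_one)
    ultimately show ?thesis unfolding RCOSETS_def using x(1) one_closed by blast
  qed
  moreover have "A \<noteq> A #> x" using coset_join1[of A x] sub xnA by auto
  ultimately have "A \<lhd> G" "comm_group (G\<lparr>carrier := A\<rparr>)" "card (rcosets A) = 2" by simp_all
  moreover have "x \<otimes> a \<otimes> inv x = inv a" if "a \<in> A" for a
    using xinv[OF that] that by (simp add: inverts_def m_assoc)
  moreover have "ord x = 4" using ord_eq_4 x by blast
  ultimately show ?thesis
    using xnA assms is_group unfolding generalized_dicyclic_def by (meson DiffI x(1))
qed

text \<open>The elements \<open>i\<close> and \<open>j\<close> generate a quaternion group of order
  8. The abelian subgroup is generated by \<open>i\<close> and all central elements of order at most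
  2, and \<open>j\<close> is the element that inverts it.\<close>

lemma generalized_dicyclic_quaternionI:
  assumes ij: "i \<in> carrier G" "j \<in> carrier G" "i \<otimes> i = j \<otimes> j" "inverts i j" "\<not> commutes i j"
    and S: "S \<subseteq> carrier G" "generate G S = carrier G"
      "\<And>s. s \<in> S \<Longrightarrow> \<exists>q \<in> {\<one>, i, j, i \<otimes> j}.
         (q \<otimes> s) \<otimes> (q \<otimes> s) = \<one> \<and> (\<forall>t \<in> S. commutes (q \<otimes> s) t)"
  shows "generalized_dicyclic G"
proof -
  define Z where "Z = {c \<in> carrier G. c \<otimes> c = \<one> \<and> (\<forall>g \<in> carrier G. commutes c g)}"
  define B where "B = insert i Z"
  have ji: "inverts j i" using inverts_flip ij by simp
  \<comment> \<open>\<open>i\<close> commutes with \<open>j \<otimes> j\<close>, which is its own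
    square, and inverts it, since it inverts \<open>j\<close>.\<close>
  have j2: "j \<otimes> j = inv (j \<otimes> j)"
  proof -
    have "i \<otimes> (i \<otimes> i) = i \<otimes> i \<otimes> i" using ij(1) by (simp add: m_assoc)
    then have "commutes i (j \<otimes> j)" unfolding ij(3) commutes_def .
    moreover have "inverts i (j \<otimes> j)"
    proof -
      have "i \<otimes> (j \<otimes> j) = inv j \<otimes> (i \<otimes> j)"
        using ij unfolding inverts_def by (metis m_assoc inv_closed)
      also have "\<dots> = inv (j \<otimes> j) \<otimes> i"
        using ij unfolding inverts_def by (metis m_assoc inv_closed inv_mult_group)
      finally show ?thesis by (simp add: inverts_def)
    qed
    ultimately show ?thesis using inverts_commutes_iff[of i "j \<otimes> j"] square_one_iff[of "j \<otimes> j"] ij by simp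
  qed
  have j4: "(j \<otimes> j) \<otimes> (j \<otimes> j) = \<one>" using j2 square_one_iff[of "j \<otimes> j"] ij by simp
  have BC: "B \<subseteq> carrier G" using ij by (auto simp: B_def Z_def)
  note bg = generate.incl[of _ B G] generate.eng[of _ G B] generate_m_inv_closed[OF BC]
  have cZ: "c \<in> generate G B" "c \<in> carrier G" if "c \<in> Z" for c using that bg by (auto simp: B_def Z_def)
  have ig: "i \<in> generate G B" "inv i \<in> generate G B" using bg by (auto simp: B_def)
  have jc: "j \<otimes> c = c \<otimes> j" "c \<otimes> j = j \<otimes> c" if "c \<in> Z" for c
    using that ij by (auto simp: Z_def commutes_def)
  show ?thesis
  proof (rule generalized_dicyclicI[of B j S])
    show "commutes b c" if "b \<in> B" "c \<in> B" for b c
      using that ij commutes_sym by (auto simp: B_def Z_def)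
    show "inverts j b" if "b \<in> B" for b
    proof -
      have "inverts j b" if "b \<in> Z"
      proof -
        have "inv b = b" using that square_one_iff by (auto simp: Z_def)
        then show ?thesis using that jc by (simp add: inverts_def)
      qed
      then show ?thesis using that ji by (auto simp: B_def)
    qed
    show "j \<otimes> j \<noteq> \<one>" using ij inverts_commutes_iff[of i j] by simp
    show "j \<otimes> j \<in> generate G B" using ig ij(3) by (metis generate.eng)
    show "\<not> comm_group G"
    proof
      assume "comm_group G"
      then interpret comm_group G .
      show False using ij m_comm by (simp add: commutes_def)
    qed
    fix s assume s: "s \<in> S"
    then obtain q where q: "q \<in> {\<one>, i, j, i \<otimes> j}" "(q \<otimes> s) \<otimes> (q \<otimes> s) = \<one>"
      "\<forall>t \<in> S. commutes (q \<otimes> s) t" using S by blast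
    have sc: "s \<in> carrier G" "q \<in> carrier G" using s S q ij by auto
    define c where "c = q \<otimes> s"
    have cZ': "c \<in> Z" unfolding Z_def c_def
      using generate_commutes[of S "q \<otimes> s"] S(1,2) q sc by auto
    note cZ = cZ[OF cZ'] jc[OF cZ']
    have sq: "s = inv q \<otimes> c" using sc by (simp add: c_def)
    \<comment> \<open>For \<open>q\<close> equal to \<open>\<one>\<close> or \<open>i\<close> the
      generator lies in the subgroup; in the other two cases multiplication by \<open>j\<close>
      carries it there.\<close>
    consider "q = \<one>" | "q = i" | "q = j" | "q = i \<otimes> j" using q by blast
    then show "s \<in> generate G B \<or> s \<otimes> j \<in> generate G B"
    proof cases
      case 1 then show ?thesis using sq cZ by simp
    next
      case 2 then show ?thesis using sq cZ ig generate.eng by fast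
    next
      case 3
      then have "s \<otimes> j = c" using sq cZ ij by (simp add: m_assoc)
      then show ?thesis using cZ by simp
    next
      case 4
      have "inv j \<otimes> inv i = i \<otimes> inv j" using ij ji inverts_inv_left[of j i]
        by (simp add: inverts_iff)
      then have "s \<otimes> j = i \<otimes> c" using sq 4 cZ ij by (simp add: m_assoc inv_mult_group)
      then show ?thesis using cZ ig by (metis generate.eng)
    qed
  qed (use S ij BC j4 in auto)
qed

end


section \<open>Colour-preserving automorphisms of a ball\<close>

context group
begin

text \<open>Keeping the identity, unlike \<open>products_upto\<close>, makes this the vertex set of
  the ball.\<close>

definition words :: "nat \<Rightarrow> 'a set \<Rightarrow> 'a set"
  where "words n S = {foldr (\<otimes>) ss \<one> | ss. set ss \<subseteq> symm G S \<and> length ss \<le> n}"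

lemma products_upto_eq_words: "products_upto G n S = words n S - {\<one>}"
  by (simp add: products_upto_def words_def)

lemma one_in_words [simp]: "\<one> \<in> words n S"
  unfolding words_def by (intro CollectI exI[of _ "[]"]) auto

lemma words_Suc_I:
  assumes "s \<in> symm G S" "x \<in> words n S"
  shows "s \<otimes> x \<in> words (Suc n) S"
proof -
  obtain ss where "x = foldr (\<otimes>) ss \<one>" "set ss \<subseteq> symm G S" "length ss \<le> n"
    using assms by (auto simp: words_def)
  then show ?thesis
    unfolding words_def using assms by (intro CollectI exI[of _ "s # ss"]) auto
qed

lemma words_mono: "m \<le> n \<Longrightarrow> words m S \<subseteq> words n S"
  unfolding words_def by fastforce

lemma words_carrier:
  assumes "S \<subseteq> carrier G"
  shows "words n S \<subseteq> carrier G"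
proof -
  have "foldr (\<otimes>) ss \<one> \<in> carrier G" if "set ss \<subseteq> symm G S" for ss
    using that symm_carrier[OF assms] by (induction ss) auto
  then show ?thesis by (auto simp: words_def)
qed

lemma words_inv:
  assumes "S \<subseteq> carrier G" "x \<in> words n S"
  shows "inv x \<in> words n S"
proof -
  have app: "foldr (\<otimes>) (ss @ ts) \<one> = foldr (\<otimes>) ss \<one> \<otimes> foldr (\<otimes>) ts \<one>"
    if "set ss \<subseteq> symm G S" "set ts \<subseteq> symm G S" for ss ts
  proof -
    have c: "foldr (\<otimes>) us \<one> \<in> carrier G" if "set us \<subseteq> symm G S" for us
      using that symm_carrier[OF assms(1)] by (induction us) auto
    show ?thesis using that c[of ts] symm_carrier[OF assms(1)]
    proof (induction ss)
      case (Cons s ss)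
      then show ?case using c[of ss] by (simp add: m_assoc subset_iff)
    qed simp
  qed
  have "\<exists>ts. set ts \<subseteq> symm G S \<and> length ts = length ss \<and> inv (foldr (\<otimes>) ss \<one>) = foldr (\<otimes>) ts \<one>"
    if "set ss \<subseteq> symm G S" for ss
    using that
  proof (induction ss)
    case (Cons s ss)
    then obtain ts where ts: "set ts \<subseteq> symm G S" "length ts = length ss"
      "inv (foldr (\<otimes>) ss \<one>) = foldr (\<otimes>) ts \<one>" by auto
    have s: "s \<in> symm G S" "inv s \<in> symm G S" "s \<in> carrier G"
      using Cons symm_inv[OF assms(1)] symm_carrier[OF assms(1)] by auto
    have "foldr (\<otimes>) ss \<one> \<in> carrier G"
      using words_carrier[OF assms(1), of "length ss"] Cons.prems by (auto simp: words_def)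
    then have "inv (foldr (\<otimes>) (s # ss) \<one>) = foldr (\<otimes>) (ts @ [inv s]) \<one>"
      using app[of ts "[inv s]"] ts s by (simp add: inv_mult_group)
    then show ?case using ts s by (intro exI[of _ "ts @ [inv s]"]) auto
  qed simp
  then show ?thesis using assms(2) unfolding words_def by auto metis
qed

lemma symm_subset_words:
  assumes "S \<subseteq> carrier G" "1 \<le> n"
  shows "symm G S \<subseteq> words n S"
proof
  fix s assume s: "s \<in> symm G S"
  then have "s \<in> carrier G" "s \<otimes> \<one> \<in> words (Suc 0) S"
    using symm_carrier[OF assms(1)] words_Suc_I[of s S \<one> 0] by auto
  then show "s \<in> words n S"
    using words_mono[of "Suc 0" n S] assms(2) by auto
qed

end

text \<open>In \<open>phi_step\<close> the colour of the edge from \<open>g\<close> to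
  \<open>h\<close> is \<open>inv g \<otimes> h\<close>. Admitting \<open>g = h\<close> is harmless
  and avoids excluding the identity in every application.\<close>

locale ball_automorphism = group G for G (structure) +
  fixes S :: "'a set" and \<phi> :: "'a \<Rightarrow> 'a"
  assumes S: "S \<subseteq> carrier G"
    and inj: "inj_on \<phi> (words 3 S)"
    and phi_one: "\<phi> \<one> = \<one>"
    and phi_step: "\<lbrakk>g \<in> words 3 S; h \<in> words 3 S; inv g \<otimes> h \<in> words 3 S\<rbrakk>
      \<Longrightarrow> \<phi> h \<in> {\<phi> g \<otimes> (inv g \<otimes> h), \<phi> g \<otimes> (inv h \<otimes> g)}"
begin

abbreviation "M \<equiv> symm G S"
abbreviation "L \<equiv> words 3 S"

definition "flipped g \<longleftrightarrow> g \<in> L \<and> \<phi> g \<noteq> g"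
definition "fixed g \<longleftrightarrow> g \<in> L \<and> \<phi> g = g"

lemma fixed_iff: "g \<in> L \<Longrightarrow> fixed g \<longleftrightarrow> \<not> flipped g"
  by (auto simp: flipped_def fixed_def)

lemma L_carrier [simp]: "g \<in> L \<Longrightarrow> g \<in> carrier G"
  using words_carrier[OF S] by blast

lemma L_inv [simp]: "g \<in> L \<Longrightarrow> inv g \<in> L"
  using words_inv[OF S] by blast

lemma M_carrier [simp]: "s \<in> M \<Longrightarrow> s \<in> carrier G"
  using symm_carrier[OF S] by blast

lemma M_inv [simp]: "s \<in> M \<Longrightarrow> inv s \<in> M"
  using symm_inv[OF S] by blast

lemma M_L [simp]:
  assumes "s \<in> M"
  shows "s \<in> L" "t \<in> M \<Longrightarrow> s \<otimes> t \<in> L"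
    "\<lbrakk>t \<in> M; r \<in> M\<rbrakk> \<Longrightarrow> s \<otimes> (t \<otimes> r) \<in> L" "\<lbrakk>t \<in> M; r \<in> M\<rbrakk> \<Longrightarrow> s \<otimes> t \<otimes> r \<in> L"
proof -
  have w1: "x \<in> words (Suc 0) S" if "x \<in> M" for x
    using symm_subset_words[OF S, of "Suc 0"] that by auto
  show "s \<in> L" using assms symm_subset_words[OF S, of 3] by auto
  show "s \<otimes> t \<in> L" if "t \<in> M"
    using words_Suc_I[OF assms w1[OF that]] words_mono[of "Suc (Suc 0)" 3 S] by auto
  show *: "s \<otimes> (t \<otimes> r) \<in> L" if "t \<in> M" "r \<in> M"
    using words_Suc_I[OF assms words_Suc_I[OF that(1) w1[OF that(2)]]] by (simp add: numeral_eq_Suc)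
  show "s \<otimes> t \<otimes> r \<in> L" if "t \<in> M" "r \<in> M"
    using *[OF that] that assms by (simp add: m_assoc)
qed

lemma phi_cases:
  assumes "g \<in> L" shows "\<phi> g = g \<or> \<phi> g = inv g"
  using phi_step[of \<one> g] assms by (auto simp: phi_one)

text \<open>Any other combination of images would identify the images of \<open>g\<close> and
  \<open>inv g\<close>, against injectivity.\<close>

lemma phi_inv:
  assumes "g \<in> L" shows "\<phi> (inv g) = inv (\<phi> g)"
  using phi_cases[OF assms] phi_cases[OF L_inv[OF assms]] inj_onD[OF inj, of g "inv g"] assms
  by auto

lemma phi_mult_right:
  assumes "u \<in> L" "v \<in> L" "u \<otimes> v \<in> L"
  shows "\<phi> (u \<otimes> v) = \<phi> u \<otimes> v \<or> \<phi> (u \<otimes> v) = \<phi> u \<otimes> inv v"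
  using phi_step[of u "u \<otimes> v"] assms by (auto simp: inv_mult_group m_assoc)

text \<open>The rule for the right factor, applied to \<open>inv v \<otimes> inv u\<close>, becomes
  a rule for the left factor after taking inverses.\<close>

lemma phi_mult_left:
  assumes "u \<in> L" "v \<in> L" "u \<otimes> v \<in> L"
  shows "\<phi> (u \<otimes> v) = u \<otimes> \<phi> v \<or> \<phi> (u \<otimes> v) = inv u \<otimes> \<phi> v"
proof -
  have c: "\<phi> v \<in> carrier G" "\<phi> (u \<otimes> v) \<in> carrier G"
    using phi_cases[OF assms(2)] phi_cases[OF assms(3)] assms by auto
  have "inv (\<phi> (u \<otimes> v)) = \<phi> (inv v \<otimes> inv u)"
    using assms phi_inv[OF assms(3)] by (simp add: inv_mult_group)
  also have "\<dots> = inv (\<phi> v) \<otimes> inv u \<or> \<dots> = inv (\<phi> v) \<otimes> u"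
    using phi_mult_right[of "inv v" "inv u"] assms L_inv[OF assms(3)] phi_inv[OF assms(2)]
    by (simp add: inv_mult_group)
  finally have "\<phi> (u \<otimes> v) = inv (inv (\<phi> v) \<otimes> inv u) \<or> \<phi> (u \<otimes> v) = inv (inv (\<phi> v) \<otimes> u)"
    using c by (metis inv_inv)
  then show ?thesis using c assms by (simp add: inv_mult_group)
qed

lemma flippedD:
  assumes "flipped u"
  shows "\<phi> u = inv u" "u \<otimes> u \<noteq> \<one>" "u \<in> L" "u \<in> carrier G" "inv u \<noteq> u" "flipped (inv u)"
proof -
  show 1: "u \<in> L" "u \<in> carrier G" "\<phi> u = inv u" using assms phi_cases[of u] by (auto simp: flipped_def)
  show 2: "inv u \<noteq> u" using assms 1 by (simp add: flipped_def)
  show "u \<otimes> u \<noteq> \<one>" using square_one_iff 1 2 by simp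
  show "flipped (inv u)" unfolding flipped_def using 1 2 by (simp add: phi_inv)
qed

lemma fixedD: "fixed u \<Longrightarrow> \<phi> u = u" "fixed u \<Longrightarrow> u \<in> L" "fixed u \<Longrightarrow> u \<in> carrier G"
  by (auto simp: fixed_def)

lemma involution_fixed: "u \<in> L \<Longrightarrow> u \<otimes> u = \<one> \<Longrightarrow> fixed u"
  using flippedD(2) fixed_iff by blast

text \<open>If \<open>u \<otimes> v\<close> is fixed, follow the edge from \<open>inv u\<close> to
  \<open>v\<close>: one option would make \<open>u \<otimes> u\<close> trivial, the other is the
  claim. If it is moved, the rule for the left factor leaves only \<open>inv u \<otimes> v\<close>
  as its image.\<close>

lemma flipped_inverts_fixed:
  assumes "flipped u" "fixed v" "u \<otimes> v \<in> L"
  shows "inverts u v"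
proof -
  note u = flippedD[OF assms(1)] and v = fixedD[OF assms(2)]
  show ?thesis
  proof (cases "fixed (u \<otimes> v)")
    case True
    have "u \<otimes> (u \<otimes> v) = v \<or> u \<otimes> (inv v \<otimes> inv u) = v"
      using phi_mult_right[of "inv u" "u \<otimes> v"] u v assms(3) flippedD(1)[OF u(6)]
      by (auto simp: inv_mult_group)
    moreover have "u \<otimes> (u \<otimes> v) \<noteq> v"
      using u v r_cancel[of "u \<otimes> u" v \<one>] by (auto simp: m_assoc)
    ultimately have "u \<otimes> (inv v \<otimes> inv u) \<otimes> u = v \<otimes> u" by simp
    then show ?thesis using u v by (simp add: inverts_iff m_assoc)
  next
    case False
    then have "flipped (u \<otimes> v)" using assms(3) fixed_iff by blast
    note uv = flippedD[OF this]
    have "inv v \<otimes> inv u = inv u \<otimes> v"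
      using phi_mult_left[OF u(3) v(2) assms(3)] u v uv by (simp add: inv_mult_group)
    then have "inverts (inv u) v" by (simp add: inverts_def)
    then show ?thesis using u v by simp
  qed
qed

text \<open>Along the edge from \<open>u\<close>, the image of \<open>u \<otimes> v\<close> is
  \<open>inv u \<otimes> v\<close> or \<open>inv u \<otimes> inv v\<close>; the first differs from
  \<open>u \<otimes> v\<close> because \<open>u\<close> is not its own inverse.\<close>

lemma flipped_mult_fixed:
  assumes "flipped u" "fixed (u \<otimes> v)" "v \<in> L"
  shows "u \<otimes> u = inv (v \<otimes> v)"
proof -
  note u = flippedD[OF assms(1)] and uv = fixedD[OF assms(2)]
  have "u \<otimes> v = inv u \<otimes> v \<or> u \<otimes> v = inv u \<otimes> inv v"
    using phi_mult_right[OF u(3) assms(3) uv(2)] u uv by simp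
  then have "u \<otimes> v = inv u \<otimes> inv v" using u assms(3) by auto
  then show ?thesis by (rule square_eq_inv_square[OF u(4) L_carrier[OF assms(3)]])
qed

text \<open>The inverse in the previous conclusion disappears: \<open>u\<close> commutes with its
  own square, hence with \<open>v \<otimes> v\<close>, but it also inverts
  \<open>v \<otimes> v\<close>.\<close>

lemma flipped_fixed_square:
  assumes "flipped u" "fixed v" "fixed (u \<otimes> v)"
  shows "u \<otimes> u = v \<otimes> v"
proof -
  note u = flippedD[OF assms(1)] and v = fixedD[OF assms(2)]
  have i: "inverts u v" using flipped_inverts_fixed assms fixedD by blast
  have s: "u \<otimes> u = inv (v \<otimes> v)" using flipped_mult_fixed assms v by blast
  have "commutes u (v \<otimes> v)"
  proof -
    have "commutes u (u \<otimes> u)" using u by (simp add: commutes_def m_assoc)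
    then show ?thesis using s u v by simp
  qed
  moreover have "inverts u (v \<otimes> v)"
    using i u v unfolding inverts_def by (metis inv_closed inv_mult_group m_assoc)
  ultimately have "(v \<otimes> v) \<otimes> (v \<otimes> v) = \<one>" using inverts_commutes_iff[of u "v \<otimes> v"] u v by simp
  then show ?thesis using s square_one_iff[of "v \<otimes> v"] v by simp
qed

text \<open>Non-commutativity rules out \<open>inv u \<otimes> inv v\<close> as the image of the
  product, so the rules for the right and the left factor have one option left each.\<close>

lemma flipped_flipped_flipped:
  assumes "flipped u" "flipped v" "flipped (u \<otimes> v)" "\<not> commutes u v"
  shows "inverts u v" "inverts v u"
proof -
  note u = flippedD[OF assms(1)] and v = flippedD[OF assms(2)] and uv = flippedD[OF assms(3)]
  have n: "inv v \<otimes> inv u \<noteq> inv u \<otimes> inv v"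
  proof
    assume "inv v \<otimes> inv u = inv u \<otimes> inv v"
    then have "commutes (inv u) (inv v)" by (simp add: commutes_def)
    then show False using assms(4) u(4) v(4) by simp
  qed
  have "inv v \<otimes> inv u = inv u \<otimes> v"
    using phi_mult_right[OF u(3) v(3) uv(3)] u v uv n by (simp add: inv_mult_group)
  then have "inverts (inv u) v" by (simp add: inverts_def)
  then show "inverts u v" using u v by simp
  have "inv v \<otimes> inv u = u \<otimes> inv v"
    using phi_mult_left[OF u(3) v(3) uv(3)] u v uv n by (simp add: inv_mult_group)
  then have "inverts (inv v) (inv u)" using u by (simp add: inverts_def)
  then show "inverts v u" using u v by simp
qed

lemma flipped_flipped_square_inv:
  assumes "flipped u" "flipped v" "u \<otimes> v \<in> L" "\<not> commutes u v"
  shows "u \<otimes> u = inv (v \<otimes> v)"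
proof (cases "fixed (u \<otimes> v)")
  case True
  then show ?thesis using flipped_mult_fixed assms flippedD by blast
next
  case False
  note u = flippedD[OF assms(1)] and v = flippedD[OF assms(2)]
  have "inverts u v" "inverts v u"
    using flipped_flipped_flipped assms False fixed_iff by blast+
  \<comment> \<open>Substituting the first equation into the second gives
    \<open>v \<otimes> u \<otimes> u \<otimes> v = \<one>\<close>.\<close>
  then have "u \<otimes> (v \<otimes> u) = v" "v \<otimes> (u \<otimes> v) = u" using u v by (simp_all add: inverts_def)
  then have "v \<otimes> (u \<otimes> (u \<otimes> (v \<otimes> u))) = u" by metis
  then have "(v \<otimes> u \<otimes> u \<otimes> v) \<otimes> u = \<one> \<otimes> u" using u v by (simp add: m_assoc)
  then have "v \<otimes> u \<otimes> u \<otimes> v = \<one>" using u v by (meson m_closed one_closed r_cancel)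
  then have "v \<otimes> (u \<otimes> u) = inv v" using u v inv_equality[of "v \<otimes> (u \<otimes> u)" v] by (simp add: m_assoc)
  then have "inv v \<otimes> (v \<otimes> (u \<otimes> u)) = inv v \<otimes> inv v" by simp
  then show ?thesis using u v by (simp add: inv_mult_group)
qed

text \<open>The pairs \<open>u\<close>, \<open>inv v\<close> and \<open>u\<close>, \<open>v\<close>
  express the square of \<open>u\<close> as \<open>v \<otimes> v\<close> and as its inverse.\<close>

lemma flipped_flipped_square:
  assumes "flipped u" "flipped v" "u \<otimes> v \<in> L" "u \<otimes> inv v \<in> L" "\<not> commutes u v"
  shows "u \<otimes> u = v \<otimes> v" "inv (v \<otimes> v) = v \<otimes> v"
proof -
  note u = flippedD[OF assms(1)] and v = flippedD[OF assms(2)]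
  show 1: "u \<otimes> u = v \<otimes> v"
    using flipped_flipped_square_inv[OF assms(1) v(6) assms(4)] assms(5) u v by (simp add: inv_mult_group)
  show "inv (v \<otimes> v) = v \<otimes> v"
    using flipped_flipped_square_inv[OF assms(1,2,3,5)] 1 by simp
qed

text \<open>Each of the two rules leaves a single value for the image of the product, and together
  they give mutual inversion. If the factors commuted, \<open>w \<otimes> w\<close> and with it the
  square of the moved product would be trivial.\<close>

lemma fixed_fixed_flipped:
  assumes "fixed v" "fixed w" "flipped (v \<otimes> w)"
  shows "v \<otimes> v = w \<otimes> w" "inverts v w" "inverts w v" "\<not> commutes v w"
proof -
  note v = fixedD[OF assms(1)] and w = fixedD[OF assms(2)] and vw = flippedD[OF assms(3)]
  have 1: "inv w \<otimes> inv v = v \<otimes> inv w"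
    using phi_mult_right[OF v(2) w(2) vw(3)] v w vw by (auto simp: inv_mult_group)
  then have "inverts (inv w) (inv v)" using v by (simp add: inverts_def)
  then show "inverts w v" using v w by simp
  have 2: "inv w \<otimes> inv v = inv v \<otimes> w"
    using phi_mult_left[OF v(2) w(2) vw(3)] v w vw by (auto simp: inv_mult_group)
  then have "inverts (inv v) w" by (simp add: inverts_def)
  then show i: "inverts v w" using v w by simp
  have "v \<otimes> (v \<otimes> inv w) \<otimes> w = v \<otimes> (inv v \<otimes> w) \<otimes> w" using 1 2 by simp
  then show s: "v \<otimes> v = w \<otimes> w" using v w by (simp add: m_assoc)
  show "\<not> commutes v w"
    using inverts_commutes_iff[OF v(3) w(3) i] square_if_inverts[OF v(3) w(3) i] s vw(2) by auto
qed

text \<open>The pair \<open>a\<close>, \<open>b\<close> certifies that the generators do not all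
  commute. If two moved generators fail to commute, their common square is the reference value;
  otherwise a fixed generator with non-trivial square supplies non-commuting words; without such a
  generator everything would commute.\<close>

lemma flipped_squares:
  assumes nc: "a \<in> M" "b \<in> M" "\<not> commutes a b"
    and f: "f \<in> M" "flipped f" and g: "g \<in> M" "flipped g"
  shows "f \<otimes> f = g \<otimes> g" "inv (f \<otimes> f) = f \<otimes> f"
proof -
  have "f \<otimes> f = g \<otimes> g \<and> inv (f \<otimes> f) = f \<otimes> f"
  proof (cases "\<exists>u v. u \<in> M \<and> v \<in> M \<and> flipped u \<and> flipped v \<and> \<not> commutes u v")
    case True
    then obtain u v where u: "u \<in> M" "flipped u" and v: "v \<in> M" "flipped v" and uv: "\<not> commutes u v"
      by blast
    note nc2 = flipped_flipped_square[OF u(2) v(2) _ _ uv]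
    have z: "u \<otimes> u = v \<otimes> v" "inv (v \<otimes> v) = v \<otimes> v" using nc2 u v by simp_all
    have "w \<otimes> w = u \<otimes> u" if w: "w \<in> M" "flipped w" for w
    proof (cases "commutes u w \<and> commutes v w")
      case False
      then show ?thesis
        using flipped_flipped_square(1)[OF u(2) w(2)] flipped_flipped_square(1)[OF v(2) w(2)] u v w z
        by auto
    next
      case True
      have uwL: "u \<otimes> w \<in> L" using u w by simp
      show ?thesis
      proof (cases "fixed (u \<otimes> w)")
        case True
        then have "u \<otimes> u = inv (w \<otimes> w)" using flipped_mult_fixed u w by simp
        then have "inv (u \<otimes> u) = w \<otimes> w" using w by simp
        then show ?thesis using z by simp
      next
        case False
        then have fl: "flipped (u \<otimes> w)" using uwL fixed_iff by blast
        \<comment> \<open>The moved word \<open>u \<otimes> w\<close> can be compared with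
          \<open>v\<close> since three letters are allowed; the equality of their squares would make
          \<open>w \<otimes> w\<close> trivial.\<close>
        have "\<not> commutes (u \<otimes> w) v"
        proof
          assume "commutes (u \<otimes> w) v"
          then have "commutes (u \<otimes> w \<otimes> inv w) v"
            using True u v w commutes_mult_left[of "u \<otimes> w" v "inv w"] by (simp add: commutes_sym)
          then show False using uv u w by (simp add: m_assoc)
        qed
        then have "(u \<otimes> w) \<otimes> (u \<otimes> w) = v \<otimes> v"
          using flipped_flipped_square(1)[OF fl v(2)] u v w by simp
        then have "(u \<otimes> u) \<otimes> (w \<otimes> w) = (u \<otimes> u) \<otimes> \<one>"
          using square_if_commutes[of u w] True u(1) v(1) w(1) z by simp
        then have "w \<otimes> w = \<one>" by (metis M_carrier l_cancel m_closed one_closed u(1) w(1))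
        then show ?thesis using flippedD(2)[OF w(2)] by blast
      qed
    qed
    then show ?thesis using f g z by simp
  next
    case False
    then have FF: "commutes u v" if "u \<in> M" "v \<in> M" "flipped u" "flipped v" for u v
      using that by blast
    have FK: "inverts u v" if "u \<in> M" "v \<in> M" "flipped u" "fixed v" for u v
      using that flipped_inverts_fixed by simp
    show ?thesis
    proof (cases "\<exists>v \<in> M. fixed v \<and> v \<otimes> v \<noteq> \<one>")
      case True
      then obtain v where v: "v \<in> M" "fixed v" "v \<otimes> v \<noteq> \<one>" by blast
      have fx: "x \<otimes> x = v \<otimes> v" if "x \<in> M" "flipped x" "fixed (x \<otimes> v)" for x
        using flipped_fixed_square that v by blast
      \<comment> \<open>\<open>x\<close> commutes with \<open>y\<close> but inverts
        \<open>v\<close>, whose square is not trivial. So \<open>x\<close> does not commute with the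
        moved word \<open>y \<otimes> v\<close>, which has the same square as
        \<open>y\<close>.\<close>
      have fl: "x \<otimes> x = y \<otimes> y \<and> inv (y \<otimes> y) = y \<otimes> y"
        if x: "x \<in> M" "flipped x" and y: "y \<in> M" "flipped y" "\<not> fixed (y \<otimes> v)" for x y
      proof -
        have f: "flipped (y \<otimes> v)" using y v fixed_iff by simp
        have nc: "\<not> commutes x (y \<otimes> v)"
        proof
          assume "commutes x (y \<otimes> v)"
          then have "commutes (inv y \<otimes> (y \<otimes> v)) x"
            using FF[OF x(1) y(1) x(2) y(2)] x y v commutes_sym by (subst commutes_mult_left) simp_all
          then have "commutes x v" using y v commutes_sym[of x v] by simp
          then show False using inverts_commutes_iff[OF _ _ FK[OF x(1) v(1) x(2) v(2)]] x v by simp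
        qed
        have s: "(y \<otimes> v) \<otimes> (y \<otimes> v) = y \<otimes> y"
          using square_if_inverts FK y v by simp
        have "x \<otimes> inv (y \<otimes> v) \<in> L" using x y v by (simp add: inv_mult_group)
        then show ?thesis
          using flipped_flipped_square[OF x(2) f _ _ nc] x y v s by simp
      qed
      show ?thesis
      proof (cases "fixed (f \<otimes> v) \<and> fixed (g \<otimes> v)")
        case True
        then have "f \<otimes> f = v \<otimes> v" "g \<otimes> g = v \<otimes> v" using fx f g by auto
        moreover have "f \<otimes> f = inv (v \<otimes> v)" using flipped_mult_fixed True f v by simp
        ultimately show ?thesis using v by simp
      next
        case False
        then show ?thesis using fl f g by metis
      qed
    next
      case False
      \<comment> \<open>Inverting an involution is commuting with it, so moved generators commute
        with fixed ones. Fixed ones commute with each other because \<open>f\<close> inverts both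
        and their product.\<close>
      then have K1: "v \<otimes> v = \<one>" if "v \<in> M" "fixed v" for v using that by blast
      have FKc: "commutes u v" if "u \<in> M" "v \<in> M" "flipped u" "fixed v" for u v
        using that FK[OF that] K1 inverts_commutes_iff[of u v] by simp
      have KK: "commutes v w" if "v \<in> M" "w \<in> M" "fixed v" "fixed w" for v w
      proof (rule ccontr)
        assume n: "\<not> commutes v w"
        have "fixed (v \<otimes> w)"
          using fixed_fixed_flipped(2)[OF that(3,4)] that inverts_commutes_iff[of v w] K1 n fixed_iff
          by (metis M_L(2) M_carrier)
        then have "inverts f (v \<otimes> w)" using f that flipped_inverts_fixed by simp
        then show False using commutes_if_inverts_mult[of f v w] FK that f n by simp
      qed
      have "commutes a b"
        using FF[of a b] FKc[of a b] FKc[of b a] KK[of a b] nc(1,2) fixed_iff[of a] fixed_iff[of b]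
          commutes_sym[of a b] by auto
      then show ?thesis using nc by blast
    qed
  qed
  then show "f \<otimes> f = g \<otimes> g" "inv (f \<otimes> f) = f \<otimes> f" by blast+
qed

end


section \<open>Balls in which a generator is moved\<close>

locale moving_ball_automorphism = ball_automorphism +
  fixes f0 :: 'a
  assumes generate_S: "generate G S = carrier G"
    and f0: "f0 \<in> M" "flipped f0"
    and noncomm: "\<not> comm_group G"
begin

lemma S_M: "S \<subseteq> M"
  by (simp add: symm_def)

lemma noncommuting_generators:
  obtains a b where "a \<in> M" "b \<in> M" "\<not> commutes a b"
proof -
  have "\<exists>a \<in> M. \<exists>b \<in> M. \<not> commutes a b"
  proof (rule ccontr)
    assume "\<not> ?thesis"
    then have c: "commutes a b" if "a \<in> S" "b \<in> S" for a b using that S_M by blast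
    have 1: "commutes a g" if "a \<in> S" "g \<in> carrier G" for a g
      using generate_commutes[of S a g] c that S generate_S by blast
    have "commutes h g" if "h \<in> carrier G" "g \<in> carrier G" for h g
      using generate_commutes[of S h g] 1 that S generate_S commutes_sym by blast
    then have "comm_group G" by (intro group_comm_groupI) (simp add: commutes_def)
    then show False using noncomm by blast
  qed
  then show ?thesis using that by blast
qed

lemma square_eq:
  assumes "f \<in> M" "flipped f" "g \<in> M" "flipped g"
  shows "f \<otimes> f = g \<otimes> g"
  using noncommuting_generators flipped_squares(1) assms by metis

lemma fourth_power:
  assumes "f \<in> M" "flipped f"
  shows "(f \<otimes> f) \<otimes> (f \<otimes> f) = \<one>"
proof -
  have "inv (f \<otimes> f) = f \<otimes> f"
    using noncommuting_generators flipped_squares(2) assms by metis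
  then show ?thesis using assms by (simp add: square_one_iff)
qed

lemma flipped_inverts:
  assumes "f \<in> M" "flipped f" "v \<in> M" "fixed v"
  shows "inverts f v"
  using assms flipped_inverts_fixed by simp

lemma fixed_commute_if_fixed_mult:
  assumes "v \<in> M" "w \<in> M" "fixed v" "fixed w" "fixed (v \<otimes> w)"
  shows "commutes v w"
  using commutes_if_inverts_mult[of f0 v w] flipped_inverts_fixed[of f0 "v \<otimes> w"]
    flipped_inverts f0 assms by simp

text \<open>The hypothesis makes every product \<open>f0 \<otimes> f\<close> fixed. All members of
  \<open>B\<close> are then inverted by every moved generator, and a product of two moved generators
  commutes with them by the sign rule.\<close>

lemma generalized_dicyclic_if_no_quaternion:
  assumes no: "\<And>u v. \<lbrakk>u \<in> M; v \<in> M; \<not> commutes u v; flipped u \<longleftrightarrow> flipped v\<rbrakk> \<Longrightarrow> fixed (u \<otimes> v)"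
  shows "generalized_dicyclic G"
proof -
  define F where "F = {f \<in> M. flipped f}"
  define K where "K = {v \<in> M. fixed v}"
  define B where "B = K \<union> (\<otimes>) f0 ` F"
  have K: "v \<in> M" "fixed v" "v \<in> carrier G" if "v \<in> K" for v using that by (auto simp: K_def)
  have F: "f \<in> M" "flipped f" "f \<in> carrier G" if "f \<in> F" for f using that by (auto simp: F_def)
  have f0F: "f0 \<in> F" "f0 \<in> carrier G" using f0 by (auto simp: F_def)
  have KK: "commutes v w" if "v \<in> K" "w \<in> K" for v w
    using no[of v w] fixed_commute_if_fixed_mult[of v w] K[OF that(1)] K[OF that(2)] fixed_iff by auto
  have fx: "fixed (f0 \<otimes> f)" if f: "f \<in> F" for f
  proof (cases "commutes f0 f")
    case True
    \<comment> \<open>The two squares agree and have order 2, so the product has trivial square, and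
      such an element cannot be moved.\<close>
    then have "(f0 \<otimes> f) \<otimes> (f0 \<otimes> f) = (f \<otimes> f) \<otimes> (f \<otimes> f)"
      using square_if_commutes[of f0 f] square_eq[of f0 f] F[OF f] f0F f0 by simp
    then show ?thesis using fourth_power F[OF f] f0 by (intro involution_fixed) simp_all
  next
    case False
    then show ?thesis using no F[OF f] f0 by blast
  qed
  have inv: "inverts g (f0 \<otimes> f)" if "g \<in> F" "f \<in> F" for f g
    using flipped_inverts_fixed[of g "f0 \<otimes> f"] F that fx f0 by simp
  have KF: "commutes (f0 \<otimes> f) v" if "f \<in> F" "v \<in> K" for f v
    using flipped_inverts K F that f0 by (intro commutes_mult_leftI) auto
  have FF: "commutes (f0 \<otimes> g) (f0 \<otimes> f)" if "f \<in> F" "g \<in> F" for f g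
    using inv f0F F that by (intro commutes_mult_leftI) auto
  have BC: "B \<subseteq> carrier G" using K F f0F by (auto simp: B_def)
  show ?thesis
  proof (rule generalized_dicyclicI[of B f0 S])
    show "commutes b c" if "b \<in> B" "c \<in> B" for b c
      using that KK KF FF commutes_sym by (auto simp: B_def)
    show "inverts f0 b" if "b \<in> B" for b
      using that inv f0F flipped_inverts[OF f0] K by (auto simp: B_def)
    \<comment> \<open>\<open>f0\<close> itself belongs to \<open>F\<close>, so its square is one of
      the products in \<open>B\<close>.\<close>
    show "f0 \<otimes> f0 \<in> generate G B"
      using f0F by (intro generate.incl) (auto simp: B_def)
    fix s assume "s \<in> S"
    then have s: "s \<in> M" using S_M by blast
    show "s \<in> generate G B \<or> s \<otimes> f0 \<in> generate G B"
    proof (cases "fixed s")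
      case True
      then show ?thesis using s by (intro disjI1 generate.incl) (auto simp: B_def K_def)
    next
      case False
      then have sF: "s \<in> F" using s fixed_iff by (auto simp: F_def)
      define b where "b = f0 \<otimes> s"
      have b: "b \<in> B" "b \<in> carrier G" using sF s f0F by (auto simp: B_def b_def)
      have "inverts (inv f0) b" using inv[OF f0F(1) sF] b f0F by (simp add: b_def)
      then have "inv f0 \<otimes> b \<otimes> f0 = inv b" using b f0F by (simp add: inverts_def m_assoc)
      then have "s \<otimes> f0 = inv b" using s f0F by (simp add: b_def)
      then show ?thesis using b by (simp add: generate.inv)
    qed
  qed (use BC f0F S generate_S noncomm flippedD(2)[OF f0(2)] fourth_power[OF f0] in auto)
qed

section \<open>Moved generators that generate a quaternion group\<close>

definition quaternionic :: "'a \<Rightarrow> 'a \<Rightarrow> bool"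
  where "quaternionic u v \<longleftrightarrow> u \<in> M \<and> v \<in> M \<and> flipped u \<and> flipped v \<and> \<not> commutes u v \<and> flipped (u \<otimes> v)"

lemma quaternionicD:
  assumes "quaternionic u v"
  shows "u \<in> M" "v \<in> M" "u \<in> carrier G" "v \<in> carrier G" "flipped u" "flipped v" "\<not> commutes u v"
    "flipped (u \<otimes> v)" "inverts u v" "inverts v u" "quaternionic v u"
proof -
  show 1: "u \<in> M" "v \<in> M" "u \<in> carrier G" "v \<in> carrier G" "flipped u" "flipped v" "\<not> commutes u v"
    "flipped (u \<otimes> v)" using assms by (auto simp: quaternionic_def)
  then show 2: "inverts u v" "inverts v u" using flipped_flipped_flipped by blast+
  have "v \<otimes> u = inv (u \<otimes> v)" using 1 2 by (simp add: inverts_def inv_mult_group)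
  then have "flipped (v \<otimes> u)" using flippedD(6)[OF 1(8)] by simp
  then show "quaternionic v u" using 1 commutes_sym by (simp add: quaternionic_def)
qed

text \<open>Suppose the product \<open>a\<close> of \<open>i\<close> and \<open>f\<close> is fixed.
  Both \<open>i\<close> and \<open>j\<close> invert it, so \<open>i \<otimes> j\<close> commutes
  with it. But \<open>i \<otimes> j \<otimes> a\<close> equals the short word
  \<open>j \<otimes> f\<close>, because \<open>i \<otimes> j \<otimes> i = j\<close>, so the moved
  element \<open>i \<otimes> j\<close> also inverts \<open>a\<close>. Hence \<open>a\<close> is its
  own inverse, and \<open>i\<close> commutes with \<open>a\<close> and with
  \<open>f\<close>.\<close>

lemma quaternionic_if_noncommuting:
  assumes "quaternionic i j" and f: "f \<in> M" "flipped f" "\<not> commutes i f"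
  shows "quaternionic i f"
proof -
  note Q = quaternionicD[OF assms(1)]
  have "flipped (i \<otimes> f)"
  proof (rule ccontr)
    assume "\<not> flipped (i \<otimes> f)"
    define a where "a = i \<otimes> f"
    have a: "fixed a" "a \<in> carrier G" using \<open>\<not> flipped (i \<otimes> f)\<close> Q f by (simp_all add: fixed_iff a_def)
    have ia: "inverts i a" and ja: "inverts j a"
      using flipped_inverts_fixed[OF _ a(1)] Q f by (simp_all add: a_def)
    have c: "commutes (i \<otimes> j) a" using ia ja Q a by (intro commutes_mult_leftI) auto
    have "i \<otimes> (j \<otimes> i) = j" using Q by (simp add: inverts_def)
    then have "i \<otimes> j \<otimes> a = j \<otimes> f" using Q f by (simp add: a_def flip: m_assoc)
    then have "inverts (i \<otimes> j) a" using flipped_inverts_fixed[OF Q(8) a(1)] Q f by simp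
    then have "a \<otimes> a = \<one>" using inverts_commutes_iff c Q a by simp
    then have "commutes i a" using inverts_commutes_iff ia Q a by simp
    then have "commutes (inv i \<otimes> a) i"
      using Q a by (intro commutes_mult_leftI) (simp_all add: commutes_sym)
    then show False using f Q by (simp add: a_def commutes_sym)
  qed
  then show ?thesis using Q f by (simp add: quaternionic_def)
qed

text \<open>\<open>i \<otimes> f\<close> has trivial square, so it is fixed, inverted by
  \<open>j\<close>, and thus commutes with \<open>j\<close>. If \<open>f\<close> commuted with
  \<open>j\<close> as well, so would \<open>i\<close>.\<close>

lemma quaternionic_not_both_commute:
  assumes "quaternionic i j" and f: "f \<in> M" "flipped f" "commutes i f"
  shows "\<not> commutes j f"
proof
  assume jf: "commutes j f"
  note Q = quaternionicD[OF assms(1)]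
  define c where "c = i \<otimes> f"
  have cc: "c \<otimes> c = \<one>"
    using square_if_commutes[of i f] square_eq[of i f] fourth_power[of f] Q f by (simp add: c_def)
  have c: "fixed c" "c \<in> carrier G" using cc Q f by (simp_all add: involution_fixed c_def)
  have "inverts j c" using flipped_inverts_fixed[OF Q(6) c(1)] Q f by (simp add: c_def)
  then have "commutes j c" using inverts_commutes_iff cc c Q by simp
  then have "commutes (c \<otimes> inv f) j"
    using jf c Q f by (intro commutes_mult_leftI) (simp_all add: commutes_sym)
  then show False using Q f by (simp add: c_def m_assoc)
qed

text \<open>One quaternionic pair spreads: every moved generator fails to commute with
  \<open>i\<close> or \<open>j\<close>, so it lies in a quaternionic pair itself.\<close>

lemma quaternionic_iff_noncommuting:
  assumes "quaternionic i j" and "f \<in> M" "flipped f" "g \<in> M" "flipped g"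
  shows "quaternionic f g \<longleftrightarrow> \<not> commutes f g"
proof
  assume n: "\<not> commutes f g"
  have "\<not> commutes i f \<or> \<not> commutes j f" using quaternionic_not_both_commute assms by blast
  then have "\<exists>h. quaternionic f h"
    using quaternionic_if_noncommuting assms quaternionicD(11) by meson
  then show "quaternionic f g" using quaternionic_if_noncommuting assms n by blast
qed (simp add: quaternionic_def)

text \<open>In a quaternion group extended by central elements, non-commuting elements belong to
  different classes among those of \<open>i\<close>, \<open>j\<close> and
  \<open>i \<otimes> j\<close>; a fourth one has no place.\<close>

lemma no_four_quaternionic:
  assumes "quaternionic i j" "quaternionic i f" "quaternionic i g"
    "quaternionic j f" "quaternionic j g" "quaternionic f g"
  shows False
proof -
  note ij = quaternionicD[OF assms(1)] and fg = quaternionicD[OF assms(6)]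
  note if' = quaternionicD[OF assms(2)] and ig = quaternionicD[OF assms(3)]
  note jf = quaternionicD[OF assms(4)] and jg = quaternionicD[OF assms(5)]
  define c where "c = j \<otimes> (f \<otimes> g)"
  define p where "p = i \<otimes> j"
  \<comment> \<open>\<open>p c\<close> is again a word of length 3, namely \<open>i\<close>-inverse times \<open>f g\<close>, so the moved element \<open>p\<close> inverts,
    hence commutes with, the involution \<open>c\<close>.\<close>
  have cL: "c \<in> L" "c \<in> carrier G" using ij fg by (simp_all add: c_def)
  have pc: "p \<in> carrier G" "flipped p" using ij by (simp_all add: p_def)
  have ci: "commutes (f \<otimes> g) i" and cj: "commutes (f \<otimes> g) j"
    using ij fg if' ig jf jg by (auto intro!: commutes_mult_leftI)
  have "c \<otimes> c = (j \<otimes> j) \<otimes> (f \<otimes> f)"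
    using square_if_commutes[of j "f \<otimes> g"] cj square_if_inverts[of f g] ij fg
    by (simp add: c_def commutes_sym)
  then have cc: "c \<otimes> c = \<one>" using square_eq[of f j] fourth_power[of j] ij fg by simp
  have "i \<otimes> (j \<otimes> j) = inv i"
  proof -
    have "i \<otimes> (i \<otimes> i) \<otimes> i = \<one>" using fourth_power[of i] ij by (simp add: m_assoc)
    then have "inv i = i \<otimes> (i \<otimes> i)" using ij by (intro inv_equality) simp_all
    then show ?thesis using square_eq[of i j] ij by simp
  qed
  moreover have "p \<otimes> c = i \<otimes> (j \<otimes> j) \<otimes> (f \<otimes> g)" using ij fg by (simp add: p_def c_def m_assoc)
  ultimately have "p \<otimes> c \<in> L" using ij fg by simp
  then have "inverts p c" using flipped_inverts_fixed[OF pc(2)] cc cL involution_fixed by blast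
  then have 1: "commutes c p" using inverts_commutes_iff pc cL cc commutes_sym by blast
  \<comment> \<open>\<open>p\<close> commutes with \<open>c\<close> and with
    \<open>f \<otimes> g\<close>, hence with their quotient \<open>j\<close>; then \<open>i\<close>
    would commute with \<open>j\<close>.\<close>
  have "commutes p (f \<otimes> g)"
    using ci cj ij fg unfolding p_def by (intro commutes_mult_leftI) (simp_all add: commutes_sym)
  then have "commutes (inv (f \<otimes> g)) p" using fg pc commutes_sym by (subst commutes_inv_left) auto
  then have "commutes (c \<otimes> inv (f \<otimes> g)) p"
    using 1 cL pc fg by (intro commutes_mult_leftI) auto
  moreover have "c \<otimes> inv (f \<otimes> g) = j" using ij fg by (simp add: c_def m_assoc)
  ultimately have "commutes p j" using commutes_sym by simp
  then have "commutes (p \<otimes> inv j) j" using pc ij by (intro commutes_mult_leftI) auto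
  then show False using ij by (simp add: p_def m_assoc)
qed

lemma generalized_dicyclic_if_flipped_quaternion:
  assumes "quaternionic i j"
  shows "generalized_dicyclic G"
proof -
  note Q = quaternionicD[OF assms]
  note dich = quaternionic_iff_noncommuting[OF assms]
  \<comment> \<open>Fixed generators are central of order at most 2: \<open>i \<otimes> j\<close>
    commutes with \<open>x\<close> by the sign rule, yet inverts it as a moved element.\<close>
  have K: "x \<otimes> x = \<one>" "t \<in> M \<Longrightarrow> commutes x t" if x: "x \<in> M" "fixed x" for x t
  proof -
    have xc: "x \<in> carrier G" using x by simp
    have inv: "inverts f x" if "f \<in> M" "flipped f" for f
      using flipped_inverts that x by blast
    have c: "commutes (i \<otimes> j) x" using inv Q xc by (intro commutes_mult_leftI) auto
    have "inverts (i \<otimes> j) x" using flipped_inverts_fixed[OF Q(8) x(2)] Q x by simp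
    then show xx: "x \<otimes> x = \<one>" using c inverts_commutes_iff Q xc by simp
    show "commutes x t" if t: "t \<in> M"
    proof (cases "flipped t")
      case True
      then have "commutes t x" using inv t xx xc inverts_commutes_iff by simp
      then show ?thesis using commutes_sym by blast
    next
      case False
      then have ft: "fixed t" using t fixed_iff by simp
      show ?thesis
      proof (cases "fixed (x \<otimes> t)")
        case True
        then show ?thesis using fixed_commute_if_fixed_mult x t ft by blast
      next
        case False
        then have "inverts t x" using fixed_fixed_flipped(3)[OF x(2) ft] x t fixed_iff by simp
        then have "commutes t x" using t xx xc inverts_commutes_iff by simp
        then show ?thesis using commutes_sym by blast
      qed
    qed
  qed
  have sq: "(q \<otimes> s) \<otimes> (q \<otimes> s) = \<one>"
    if "q \<in> carrier G" "q \<otimes> q = i \<otimes> i" "s \<in> M" "flipped s" "commutes q s" for q s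
    using square_if_commutes[of q s] square_eq[of i s] fourth_power[of s] that Q by simp
  \<comment> \<open>A moved \<open>t\<close> commuting with only one of \<open>u\<close>,
    \<open>f\<close> would form a quaternionic pair with the other, and one moved generator would
    commute with both members of that pair. So \<open>u\<close> and \<open>f\<close> have equal
    signs on \<open>t\<close>.\<close>
  have aligned: "commutes (u \<otimes> f) t"
    if uv: "quaternionic u v" and f: "f \<in> M" "flipped f" "commutes u f" and t: "t \<in> M" for u v f t
  proof (cases "flipped t")
    case False
    then show ?thesis using K(2)[of t] quaternionicD[OF uv] f t fixed_iff[of t] commutes_sym
      by (intro commutes_mult_leftI) auto
  next
    case True
    note U = quaternionicD[OF uv]
    have "commutes u t \<longleftrightarrow> commutes f t"
    proof
      assume "commutes u t"
      then show "commutes f t"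
        using quaternionic_not_both_commute[of f t u] dich[OF f(1,2) t True] f(3) U(1,5) commutes_sym
        by blast
    next
      assume "commutes f t"
      then show "commutes u t"
        using quaternionic_not_both_commute[of u t f] dich[OF U(1,5) t True] f commutes_sym
        by blast
    qed
    then show ?thesis
      using dich[OF f(1,2) t True] dich[OF U(1,5) t True] U f t quaternionicD(9)
      by (intro commutes_mult_leftI) auto
  qed
  show ?thesis
  proof (rule generalized_dicyclic_quaternionI[of i j S])
    show "i \<otimes> i = j \<otimes> j" using square_eq Q by blast
    fix s assume "s \<in> S"
    then have s: "s \<in> M" using S_M by blast
    have "\<exists>q \<in> {\<one>, i, j, i \<otimes> j}. (q \<otimes> s) \<otimes> (q \<otimes> s) = \<one> \<and> (\<forall>t \<in> M. commutes (q \<otimes> s) t)"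
    proof (cases "flipped s")
      case False
      then show ?thesis using K s fixed_iff by simp
    next
      case fs: True
      consider "commutes i s" | "commutes j s" | "\<not> commutes i s" "\<not> commutes j s" by blast
      then show ?thesis
      proof cases
        case 1
        then show ?thesis using sq aligned[OF assms] s fs Q by blast
      next
        case 2
        moreover have "j \<otimes> j = i \<otimes> i" using square_eq Q by blast
        ultimately show ?thesis using sq aligned[OF Q(11)] s fs Q by blast
      next
        case 3
        then have qs: "quaternionic i s" "quaternionic j s" using dich Q s fs by blast+
        note qis = quaternionicD[OF qs(1)] and js = quaternionicD[OF qs(2)]
        have cs: "commutes (i \<otimes> j) s" using qis js by (intro commutes_mult_leftI) auto
        have "commutes (i \<otimes> j \<otimes> s) t" if t: "t \<in> M" for t
        proof (cases "flipped t")
          case False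
          then have "commutes i t" "commutes j t" "commutes s t"
            using K(2)[of t] Q s t fixed_iff[of t] commutes_sym by auto
          then show ?thesis using Q s t by (simp add: commutes_mult_left)
        next
          case True
          note d = dich[OF Q(1,5) t True] dich[OF Q(2,6) t True] dich[OF s fs t True]
          \<comment> \<open>Exactly one of \<open>i\<close>, \<open>j\<close>, \<open>s\<close>
            commutes with \<open>t\<close>: two are excluded by
            \<open>quaternionic_not_both_commute\<close>, none by
            \<open>no_four_quaternionic\<close>. The two remaining signs cancel in
            \<open>i \<otimes> j \<otimes> s\<close>.\<close>
          have "\<not> (commutes i t \<and> commutes j t)" "\<not> (commutes i t \<and> commutes s t)"
            "\<not> (commutes j t \<and> commutes s t)"
            using quaternionic_not_both_commute t True assms qs by blast+
          moreover have "commutes i t \<or> commutes j t \<or> commutes s t"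
            using no_four_quaternionic[OF assms qs(1) _ qs(2)] d by blast
          moreover have "inverts i t \<or> commutes i t" "inverts j t \<or> commutes j t" "inverts s t \<or> commutes s t"
            using d quaternionicD(9) by blast+
          ultimately consider "commutes i t" "inverts j t" "inverts s t" | "inverts i t" "commutes j t" "inverts s t"
            | "inverts i t" "inverts j t" "commutes s t" by blast
          then show ?thesis
            by cases (use Q s t in \<open>auto intro!: commutes_mult_leftI[of "i \<otimes> j"] intro: inverts_mult_left commutes_mult_left\<close>)
        qed
        moreover have "(i \<otimes> j) \<otimes> (i \<otimes> j) = i \<otimes> i" using square_if_inverts Q by simp
        ultimately show ?thesis using sq[of "i \<otimes> j" s] s fs cs Q by blast
      qed
    qed
    then show "\<exists>q \<in> {\<one>, i, j, i \<otimes> j}. (q \<otimes> s) \<otimes> (q \<otimes> s) = \<one> \<and> (\<forall>t \<in> S. commutes (q \<otimes> s) t)"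
      using S_M by blast
  qed (use Q S generate_S in auto)
qed

text \<open>Modulo central elements of order at most 2, a fixed generator is trivial or falls into
  the class of \<open>i\<close> or \<open>j\<close>, while every moved generator falls into the
  class of the moved product \<open>i \<otimes> j\<close>.\<close>

lemma generalized_dicyclic_if_fixed_quaternion:
  assumes ij: "i \<in> M" "j \<in> M" "fixed i" "fixed j" "flipped (i \<otimes> j)"
  shows "generalized_dicyclic G"
proof -
  note Q = fixed_fixed_flipped[OF ij(3-5)]
  have ijc: "i \<in> carrier G" "j \<in> carrier G" using ij by simp_all
  have jj1: "j \<otimes> j \<noteq> \<one>" using inverts_commutes_iff Q ijc by blast
  have dich: "flipped (x \<otimes> y)" "inverts x y" "inverts y x" "x \<otimes> x = y \<otimes> y"
    if "x \<in> M" "fixed x" "y \<in> M" "fixed y" "\<not> commutes x y" for x y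
  proof -
    show "flipped (x \<otimes> y)"
      using fixed_commute_if_fixed_mult[of x y] that fixed_iff[of "x \<otimes> y"] by auto
    then show "inverts x y" "inverts y x" "x \<otimes> x = y \<otimes> y"
      using fixed_fixed_flipped[of x y] that by blast+
  qed
  \<comment> \<open>The product of two non-commuting fixed generators is moved, so it inverts
    \<open>w\<close>; equal signs of \<open>x\<close> and \<open>y\<close> make it commute with
    \<open>w\<close> too.\<close>
  have invol: "w \<otimes> w = \<one>"
    if "x \<in> M" "fixed x" "y \<in> M" "fixed y" "\<not> commutes x y" and w: "w \<in> M" "fixed w"
      and "commutes x w \<and> commutes y w \<or> inverts x w \<and> inverts y w" for x y w
  proof -
    have "commutes (x \<otimes> y) w" using that by (intro commutes_mult_leftI) auto
    moreover have "inverts (x \<otimes> y) w" using flipped_inverts_fixed[OF dich(1) w(2)] that by simp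
    ultimately show ?thesis using inverts_commutes_iff that by simp
  qed
  have F: "inverts f i" "inverts f j" "fixed (f \<otimes> i)" "f \<otimes> f = i \<otimes> i" if f: "f \<in> M" "flipped f" for f
  proof -
    show fi: "inverts f i" and fj: "inverts f j" using flipped_inverts f ij by blast+
    show "fixed (f \<otimes> i)"
    proof (rule ccontr)
      \<comment> \<open>As a moved word, \<open>f \<otimes> i\<close> would invert \<open>j\<close>,
        but the sign rule makes it commute with \<open>j\<close>, whose square is not
        trivial.\<close>
      assume "\<not> fixed (f \<otimes> i)"
      then have "flipped (f \<otimes> i)" using fixed_iff f ij by simp
      then have "inverts (f \<otimes> i) j" using flipped_inverts_fixed ij f by simp
      moreover have "commutes (f \<otimes> i) j" using f ij fj Q by (intro commutes_mult_leftI) auto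
      ultimately show False using inverts_commutes_iff[of "f \<otimes> i" j] jj1 f ij by simp
    qed
    then show "f \<otimes> f = i \<otimes> i" using flipped_fixed_square f ij by blast
  qed
  have i4: "(i \<otimes> i) \<otimes> (i \<otimes> i) = \<one>" and ii1: "i \<otimes> i \<noteq> \<one>"
    using fourth_power[OF f0] F(4)[OF f0] Q jj1 by simp_all
  have central: "commutes x t" if x: "x \<in> M" "fixed x" "x \<otimes> x = \<one>" and t: "t \<in> M" for x t
  proof -
    have "commutes x t \<or> inverts t x"
      using dich(3)[OF x(1,2) t] flipped_inverts[OF t _ x(1,2)] fixed_iff t by auto
    then show ?thesis using inverts_commutes_iff[of t x] commutes_sym[of t x] x t by auto
  qed
  \<comment> \<open>\<open>u\<close> and \<open>x\<close> have equal signs on every generator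
    \<open>t\<close>. Otherwise some non-commuting pair would have equal signs on an element with
    non-trivial square, against \<open>invol\<close>.\<close>
  have aligned: "(u \<otimes> x) \<otimes> (u \<otimes> x) = \<one>" "t \<in> M \<Longrightarrow> commutes (u \<otimes> x) t"
    if u: "u \<in> M" "fixed u" "u \<otimes> u = i \<otimes> i" and v: "v \<in> M" "fixed v" "\<not> commutes u v"
      and x: "x \<in> M" "fixed x" "x \<otimes> x \<noteq> \<one>" "commutes u x" for u v x t
  proof -
    have xv: "\<not> commutes x v"
      using invol[of u v x] u v x commutes_sym by blast
    have "x \<otimes> x = i \<otimes> i" using dich(4)[of x v] dich(4)[of u v] xv u v x by simp
    then show "(u \<otimes> x) \<otimes> (u \<otimes> x) = \<one>" using square_if_commutes[of u x] i4 u x by simp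
    show "commutes (u \<otimes> x) t" if t: "t \<in> M"
    proof (cases "flipped t")
      case True
      have inv: "inverts t u" "inverts t x" using flipped_inverts t True u x by blast+
      have sq: "t \<otimes> t = u \<otimes> u" "t \<otimes> t = x \<otimes> x" using F(4)[OF t True] u \<open>x \<otimes> x = i \<otimes> i\<close> by simp_all
      then have "inverts u t" "inverts x t" using inverts_flip inv t u x by simp_all
      then show ?thesis using t u x by (intro commutes_mult_leftI) auto
    next
      case False
      then have ft: "fixed t" using t fixed_iff by simp
      have "commutes u t \<longleftrightarrow> commutes x t"
      proof
        assume ut: "commutes u t"
        show "commutes x t"
          using invol[of x t u] x t ft u ut ii1 commutes_sym by metis
      next
        assume xt: "commutes x t"
        show "commutes u t"
        proof (rule ccontr)
          assume ut: "\<not> commutes u t"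
          then have tt: "t \<otimes> t \<noteq> \<one>" using dich(4)[of u t] u t ft ii1 by simp
          have "commutes v t"
            using invol[of u v t] dich(2)[of u t] dich(2)[of v t] u v t ft ut tt by blast
          then show False using invol[of x v t] x v t ft xt xv tt by blast
        qed
      qed
      then show ?thesis using dich(2)[of u t] dich(2)[of x t] u x t ft
        by (intro commutes_mult_leftI) auto
    qed
  qed
  show ?thesis
  proof (rule generalized_dicyclic_quaternionI[of i j S])
    fix s assume "s \<in> S"
    then have s: "s \<in> M" using S_M by blast
    have "\<exists>q \<in> {\<one>, i, j, i \<otimes> j}. (q \<otimes> s) \<otimes> (q \<otimes> s) = \<one> \<and> (\<forall>t \<in> M. commutes (q \<otimes> s) t)"
    proof (cases "flipped s")
      case False
      then have fs: "fixed s" using s fixed_iff by simp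
      consider "s \<otimes> s = \<one>" | "s \<otimes> s \<noteq> \<one>" "commutes i s" | "s \<otimes> s \<noteq> \<one>" "commutes j s"
        | "s \<otimes> s \<noteq> \<one>" "\<not> commutes i s" "\<not> commutes j s" by blast
      then show ?thesis
      proof cases
        case 1
        then have "(\<one> \<otimes> s) \<otimes> (\<one> \<otimes> s) = \<one>" "\<forall>t\<in>M. commutes (\<one> \<otimes> s) t"
          using central[OF s fs] s by simp_all
        then show ?thesis by blast
      next
        case 2
        then show ?thesis using aligned[of i j s] ij Q s fs by blast
      next
        case 3
        then show ?thesis using aligned[of j i s] ij Q s fs commutes_sym by auto
      next
        case 4
        \<comment> \<open>Both \<open>i\<close> and \<open>j\<close> would invert \<open>s\<close>,
          which forces a trivial square.\<close>
        then show ?thesis using invol[of i j s] dich(2)[of i s] dich(2)[of j s] ij Q s fs by blast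
      qed
    next
      case fs: True
      note Fs = F[OF s fs]
      have c: "commutes (i \<otimes> j) t" if t: "t \<in> M" "flipped t" for t
      proof -
        have "i \<otimes> i = t \<otimes> t" "j \<otimes> j = t \<otimes> t" using F(4)[OF t] Q by simp_all
        then have "inverts i t" "inverts j t" using inverts_flip[of t] F[OF t] t ijc by simp_all
        then show ?thesis using t ijc by (intro commutes_mult_leftI) auto
      qed
      have "(i \<otimes> j) \<otimes> (i \<otimes> j) = i \<otimes> i" using square_if_inverts Q ijc by simp
      then have "(i \<otimes> j \<otimes> s) \<otimes> (i \<otimes> j \<otimes> s) = \<one>"
        using square_if_commutes[of "i \<otimes> j" s] c[OF s fs] Fs i4 s ijc by simp
      moreover have "commutes (i \<otimes> j \<otimes> s) t" if t: "t \<in> M" for t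
      proof (cases "flipped t")
        case False
        then have ft: "fixed t" using t fixed_iff by simp
        have "inverts (i \<otimes> j) t" using flipped_inverts_fixed[OF ij(5) ft] ij t by simp
        moreover have "inverts s t" using flipped_inverts s fs t ft by blast
        ultimately show ?thesis using s t ijc by (intro commutes_mult_leftI) auto
      next
        case True
        have "commutes s t"
        proof -
          \<comment> \<open>\<open>s \<otimes> i\<close> is fixed, so \<open>t\<close> inverts it.
            Since \<open>s\<close> and \<open>t\<close> also invert \<open>i\<close>, this becomes
            \<open>t \<otimes> s \<otimes> (i \<otimes> i) = inv s \<otimes> t\<close>, and
            \<open>i \<otimes> i\<close> is the square of \<open>s\<close>, of order 2.\<close>
          have tsi: "inverts t (s \<otimes> i)" using flipped_inverts_fixed[OF True Fs(3)] s t ij by simp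
          have "inverts t i" using F[OF t True] by simp
          then have e: "t \<otimes> inv i = i \<otimes> t" using t ijc inverts_iff by simp
          have "(t \<otimes> s) \<otimes> i = inv i \<otimes> inv s \<otimes> t"
            using tsi s t ijc by (simp add: inverts_def inv_mult_group m_assoc)
          also have "inv i \<otimes> inv s = inv s \<otimes> i"
            using Fs(1) inverts_inv_left[of s i] s ijc by (simp add: inverts_def)
          also have "inv s \<otimes> i \<otimes> t = inv s \<otimes> t \<otimes> inv i" using e s t ijc by (simp add: m_assoc)
          finally have "(t \<otimes> s) \<otimes> i \<otimes> i = inv s \<otimes> t \<otimes> inv i \<otimes> i" by simp
          then have "t \<otimes> s \<otimes> (i \<otimes> i) = inv s \<otimes> t" using s t ijc by (simp add: m_assoc)
          then have "t \<otimes> (s \<otimes> (s \<otimes> s)) = inv s \<otimes> t" using s t ijc by (simp add: m_assoc flip: Fs(4))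
          moreover have "s \<otimes> (s \<otimes> s) = inv s"
          proof -
            have "s \<otimes> (s \<otimes> s) \<otimes> s = \<one>" using fourth_power[OF s fs] s by (simp add: m_assoc)
            then show ?thesis using s inv_equality[of "s \<otimes> (s \<otimes> s)" s] by simp
          qed
          ultimately have "commutes t (inv s)" by (simp add: commutes_def)
          then show ?thesis using s t commutes_sym by simp
        qed
        then show ?thesis using c[OF t True] s t ijc by (intro commutes_mult_leftI) auto
      qed
      ultimately show ?thesis by blast
    qed
    then show "\<exists>q \<in> {\<one>, i, j, i \<otimes> j}. (q \<otimes> s) \<otimes> (q \<otimes> s) = \<one> \<and> (\<forall>t \<in> S. commutes (q \<otimes> s) t)"
      using S_M by blast
  qed (use Q ijc S generate_S in auto)
qed

theorem generalized_dicyclic: "generalized_dicyclic G"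
proof (cases "\<exists>u v. u \<in> M \<and> v \<in> M \<and> \<not> commutes u v \<and> (flipped u \<longleftrightarrow> flipped v) \<and> flipped (u \<otimes> v)")
  case True
  then obtain u v where "u \<in> M" "v \<in> M" "\<not> commutes u v" "flipped u \<longleftrightarrow> flipped v" "flipped (u \<otimes> v)"
    by blast
  then show ?thesis
    using generalized_dicyclic_if_flipped_quaternion[of u v]
      generalized_dicyclic_if_fixed_quaternion[of u v] fixed_iff[of u] fixed_iff[of v]
    by (auto simp: quaternionic_def)
next
  case False
  then show ?thesis
    using fixed_iff M_L(2) by (intro generalized_dicyclic_if_no_quaternion) metis
qed

end


section \<open>Orientation-rigid pairs\<close>

context group
begin

text \<open>The value 0 for infinite order does not divide 2, so one divisibility covers both
  alternatives.\<close>

lemma order_gt_2_iff: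
  assumes "x \<in> carrier G"
  shows "order_gt_2 G x \<longleftrightarrow> x \<otimes> x \<noteq> \<one>"
proof -
  have "x \<otimes> x = \<one> \<longleftrightarrow> ord x dvd 2"
    using assms pow_eq_id[of x 2] by (simp add: numeral_2_eq_2)
  also have "\<dots> \<longleftrightarrow> ord x = 1 \<or> ord x = 2"
    using two_is_prime_nat prime_nat_iff by auto
  finally show ?thesis by (auto simp: order_gt_2_def)
qed

lemma symm_products_upto:
  assumes "S \<subseteq> carrier G"
  shows "symm G (products_upto G n S) = products_upto G n S"
proof -
  have "inv x \<in> products_upto G n S" if "x \<in> products_upto G n S" for x
    using that words_inv[OF assms] words_carrier[OF assms, of n]
    by (auto simp: products_upto_eq_words subset_iff)
  then show ?thesis by (auto simp: symm_def SET_INV_def)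
qed

lemma verts_Cay_ball: "verts (Cay_ball G S) = insert \<one> (symm G S)"
  by (simp add: Cay_ball_def)

lemma verts_Cay_ball_products_upto:
  assumes "S \<subseteq> carrier G"
  shows "verts (Cay_ball G (products_upto G n S)) = words n S"
  using assms by (auto simp: verts_Cay_ball symm_products_upto) (auto simp: products_upto_eq_words)

lemma arcs_Cay_ball:
  assumes "S \<subseteq> carrier G" "x \<in> verts (Cay_ball G S)" "y \<in> verts (Cay_ball G S)"
    "inv x \<otimes> y \<in> symm G S"
  shows "(x, y) \<in> arcs (Cay_ball G S)"
  using assms symm_carrier[OF assms(1)]
  by (auto simp: Cay_ball_def Cay_def)

text \<open>Passes from the graph to the locale. The case \<open>g = h\<close> of
  \<open>phi_step\<close> is not an edge and is settled separately.\<close>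

lemma ball_automorphismI:
  assumes S: "S \<subseteq> carrier G"
    and phi: "\<phi> \<in> subgraph_colour_auts G (products_upto G 3 S) (Cay_ball G (products_upto G 3 S))"
      "\<phi> \<one> = \<one>"
  shows "ball_automorphism G S \<phi>"
proof
  let ?T = "products_upto G 3 S"
  let ?L = "words 3 S"
  note V = verts_Cay_ball_products_upto[OF S, of 3]
  have B: "bij_betw \<phi> ?L ?L" using phi V by (auto simp: subgraph_colour_auts_def Bij_def)
  then show "inj_on \<phi> ?L" by (rule bij_betw_imp_inj_on)
  show "S \<subseteq> carrier G" "\<phi> \<one> = \<one>" by fact+
  fix g h assume g: "g \<in> ?L" and h: "h \<in> ?L" and gh: "inv g \<otimes> h \<in> ?L"
  have c: "g \<in> carrier G" "h \<in> carrier G" "\<phi> g \<in> carrier G"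
    using g h words_carrier[OF S] B by (auto dest: bij_betwE)
  show "\<phi> h \<in> {\<phi> g \<otimes> (inv g \<otimes> h), \<phi> g \<otimes> (inv h \<otimes> g)}"
  proof (cases "inv g \<otimes> h = \<one>")
    case True
    then have "h = g" using c by (metis inv_equality inv_inv inv_closed)
    then show ?thesis using c by simp
  next
    case False
    then have s: "inv g \<otimes> h \<in> symm G ?T" using gh S by (simp add: symm_products_upto) (simp add: products_upto_eq_words)
    have "?T \<subseteq> carrier G" using words_carrier[OF S] by (auto simp: products_upto_eq_words)
    then have "(g, h) \<in> arcs (Cay_ball G ?T)" using g h V s by (intro arcs_Cay_ball) auto
    moreover have "\<phi> (g \<otimes> s) \<in> {\<phi> g \<otimes> s, \<phi> g \<otimes> inv s}"
      if "s \<in> symm G ?T" "(g, g \<otimes> s) \<in> arcs (Cay_ball G ?T)" for s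
      using phi that c by (simp add: subgraph_colour_auts_def)
    ultimately have "\<phi> (g \<otimes> (inv g \<otimes> h)) \<in> {\<phi> g \<otimes> (inv g \<otimes> h), \<phi> g \<otimes> inv (inv g \<otimes> h)}"
      using s c by (metis inv_cancel_left(2))
    then show ?thesis using c by (simp add: inv_mult_group)
  qed
qed

section \<open>Left translations and rigidity of the whole Cayley graph\<close>

definition left_translation :: "'a \<Rightarrow> 'a \<Rightarrow> 'a"
  where "left_translation g = (\<lambda>x \<in> carrier G. g \<otimes> x)"

lemma left_translation_colour_auts:
  assumes "T \<subseteq> carrier G" "g \<in> carrier G"
  shows "left_translation g \<in> colour_auts G T"
proof -
  have "bij_betw (left_translation g) (carrier G) (carrier G)"
    using assms(2) by (intro bij_betw_byWitness[where f' = "\<lambda>x. inv g \<otimes> x"])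
      (auto simp: left_translation_def)
  then have "left_translation g \<in> Bij (carrier G)" by (simp add: Bij_def left_translation_def)
  then show ?thesis
    using assms symm_carrier[OF assms(1)]
    by (auto simp: colour_auts_def left_translation_def m_assoc subset_iff)
qed

lemma colour_auts_translate:
  assumes T: "T \<subseteq> carrier G" and phi: "\<phi> \<in> colour_auts G T" and g: "g \<in> carrier G" "h \<in> carrier G"
  shows "(\<lambda>x \<in> carrier G. h \<otimes> \<phi> (g \<otimes> x)) \<in> colour_auts G T"
proof -
  interpret subgroup "colour_auts G T" "BijGroup (carrier G)" by (rule subgroup_colour_auts[OF T])
  have B: "\<psi> \<in> Bij (carrier G)" if "\<psi> \<in> colour_auts G T" for \<psi>
    using that by (simp add: colour_auts_def)
  note tg = left_translation_colour_auts[OF T g(1)] and th = left_translation_colour_auts[OF T g(2)]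
  have pc: "\<phi> x \<in> carrier G" if "x \<in> carrier G" for x
    using Bij_imp_funcset[OF B[OF phi]] that by blast
  have mult: "\<alpha> \<otimes>\<^bsub>BijGroup (carrier G)\<^esub> \<beta> = compose (carrier G) \<alpha> \<beta>"
    if "\<alpha> \<in> colour_auts G T" "\<beta> \<in> colour_auts G T" for \<alpha> \<beta>
    using B that by (simp add: BijGroup_def)
  have "left_translation h \<otimes>\<^bsub>BijGroup (carrier G)\<^esub> (\<phi> \<otimes>\<^bsub>BijGroup (carrier G)\<^esub> left_translation g)
      \<in> colour_auts G T"
    using phi tg th by simp
  also have "left_translation h \<otimes>\<^bsub>BijGroup (carrier G)\<^esub> (\<phi> \<otimes>\<^bsub>BijGroup (carrier G)\<^esub> left_translation g)
      = (\<lambda>x \<in> carrier G. h \<otimes> \<phi> (g \<otimes> x))"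
    using mult[OF phi tg] mult[OF th m_closed[OF phi tg]] g pc
    by (auto simp: compose_def left_translation_def fun_eq_iff)
  finally show ?thesis .
qed

text \<open>Left translations make the action transitive for every \<open>T\<close>, so only
  freeness is in question, and translating a fixed point \<open>g\<close> to the identity reduces it
  to one stabilizer.\<close>

lemma orientation_rigid_pair_iff:
  assumes T: "T \<subseteq> carrier G"
  shows "orientation_rigid_pair G T \<longleftrightarrow>
    (\<forall>\<phi> \<in> colour_auts G T. \<phi> \<one> = \<one> \<longrightarrow> (\<forall>x \<in> carrier G. \<phi> x = x))"
proof -
  let ?H = "colour_aut_group G T"
  have car: "carrier ?H = colour_auts G T" by (simp add: colour_aut_group_def)
  have one: "\<one>\<^bsub>?H\<^esub> = (\<lambda>x \<in> carrier G. x)" by (simp add: colour_aut_group_def BijGroup_def)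
  have act: "group_action ?H (carrier G) (\<lambda>\<phi>. \<phi>)" by (rule group_action_colour_aut_group[OF T])
  have ext: "\<phi> \<in> extensional (carrier G)" "\<And>x. x \<in> carrier G \<Longrightarrow> \<phi> x \<in> carrier G"
    if "\<phi> \<in> colour_auts G T" for \<phi>
    using that Bij_imp_funcset by (auto simp: colour_auts_def Bij_def)
  have id: "\<phi> = (\<lambda>x \<in> carrier G. x) \<longleftrightarrow> (\<forall>x \<in> carrier G. \<phi> x = x)" if "\<phi> \<in> colour_auts G T" for \<phi>
    using ext[OF that] by (auto simp: extensional_def fun_eq_iff)
  have idc: "(\<lambda>x \<in> carrier G. x) \<in> colour_auts G T"
    using left_translation_colour_auts[OF T, of \<one>] by (simp add: left_translation_def cong: restrict_cong)
  have trans: "transitive_action ?H (carrier G) (\<lambda>\<phi>. \<phi>)"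
  proof (intro transitive_action.intro act transitive_action_axioms.intro)
    fix x y assume "x \<in> carrier G" "y \<in> carrier G"
    then show "\<exists>\<phi> \<in> carrier ?H. \<phi> x = y"
      using left_translation_colour_auts[OF T, of "y \<otimes> inv x"]
      by (intro bexI[of _ "left_translation (y \<otimes> inv x)"]) (simp_all add: car left_translation_def m_assoc)
  qed
  have "free_action ?H (carrier G) (\<lambda>\<phi>. \<phi>) \<longleftrightarrow>
    (\<forall>\<phi> \<in> colour_auts G T. \<phi> \<one> = \<one> \<longrightarrow> (\<forall>x \<in> carrier G. \<phi> x = x))" (is "_ \<longleftrightarrow> ?R")
  proof
    assume "free_action ?H (carrier G) (\<lambda>\<phi>. \<phi>)"
    then have "stabilizer ?H (\<lambda>\<phi>. \<phi>) \<one> = {\<one>\<^bsub>?H\<^esub>}" by (simp add: free_action_def)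
    then show ?R using id by (auto simp: stabilizer_def car one)
  next
    assume R: ?R
    have "stabilizer ?H (\<lambda>\<phi>. \<phi>) g = {\<one>\<^bsub>?H\<^esub>}" if g: "g \<in> carrier G" for g
    proof -
      have "\<phi> x = x" if phi: "\<phi> \<in> colour_auts G T" "\<phi> g = g" and x: "x \<in> carrier G" for \<phi> x
      proof -
        define \<psi> where "\<psi> = (\<lambda>x \<in> carrier G. inv g \<otimes> \<phi> (g \<otimes> x))"
        have "\<psi> \<in> colour_auts G T" unfolding \<psi>_def using colour_auts_translate T phi g by simp
        moreover have "\<psi> \<one> = \<one>" using phi g by (simp add: \<psi>_def)
        ultimately have "\<psi> (inv g \<otimes> x) = inv g \<otimes> x" using R g x by blast
        then have "inv g \<otimes> \<phi> x = inv g \<otimes> x" using g x by (simp add: \<psi>_def)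
        then show ?thesis using g x ext(2)[OF phi(1) x] by simp
      qed
      then have "\<phi> = (\<lambda>x \<in> carrier G. x)" if "\<phi> \<in> colour_auts G T" "\<phi> g = g" for \<phi>
        using id[OF that(1)] that by blast
      moreover have "(\<lambda>x \<in> carrier G. x) g = g" using g by simp
      ultimately show ?thesis unfolding stabilizer_def car one using idc by blast
    qed
    then show "free_action ?H (carrier G) (\<lambda>\<phi>. \<phi>)" using act by (simp add: free_action_def)
  qed
  then show ?thesis using trans by (simp add: orientation_rigid_pair_def)
qed

text \<open>Fixing the identity forces each colour to go to itself or its inverse, so the ball is
  mapped to itself.\<close>

lemma restrict_colour_aut:
  assumes T: "T \<subseteq> carrier G" and phi: "\<phi> \<in> colour_auts G T" "\<phi> \<one> = \<one>"
  shows "restrict \<phi> (verts (Cay_ball G T)) \<in> subgraph_colour_auts G T (Cay_ball G T)"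
proof -
  let ?V = "verts (Cay_ball G T)"
  have V: "?V = insert \<one> (symm G T)" "?V \<subseteq> carrier G"
    using symm_carrier[OF T] by (auto simp: verts_Cay_ball)
  have step: "\<phi> (g \<otimes> s) \<in> {\<phi> g \<otimes> s, \<phi> g \<otimes> inv s}" if "g \<in> carrier G" "s \<in> symm G T" for g s
    using phi that by (simp add: colour_auts_def)
  have s: "\<phi> s \<in> {s, inv s}" if "s \<in> symm G T" for s
    using step[of \<one> s] that phi symm_carrier[OF T] by auto
  have inj: "inj_on \<phi> (carrier G)"
    using phi by (auto simp: colour_auts_def Bij_def bij_betw_def)
  have inj': "inj_on \<phi> ?V" using inj V inj_on_subset by blast
  have "\<phi> ` ?V = ?V"
  proof
    have "\<phi> t \<in> symm G T" if "t \<in> symm G T" for t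
      using s[OF that] symm_inv[OF T that] that by auto
    then show "\<phi> ` ?V \<subseteq> ?V" using phi by (auto simp: V(1))
    \<comment> \<open>The ball may be infinite, so surjectivity needs an argument: by injectivity,
      one of \<open>t\<close> and \<open>inv t\<close> is sent to \<open>t\<close>.\<close>
    have "t \<in> \<phi> ` ?V" if t: "t \<in> symm G T" for t
    proof -
      have tc: "t \<in> carrier G" "inv t \<in> symm G T" using symm_carrier[OF T] symm_inv[OF T] t by auto
      have "\<phi> t \<noteq> \<phi> (inv t) \<or> inv t = t" using inj_onD[OF inj] tc by fastforce
      then have "t = \<phi> t \<or> t = \<phi> (inv t)" using s[OF t] s[OF tc(2)] tc(1) by auto
      then show ?thesis using t tc by (auto simp: V)
    qed
    moreover have "\<one> \<in> \<phi> ` ?V" using phi by (auto simp: V intro: rev_image_eqI)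
    ultimately show "?V \<subseteq> \<phi> ` ?V" by (auto simp: V(1))
  qed
  then have "bij_betw \<phi> ?V ?V" using inj' by (simp add: bij_betw_def)
  then have "bij_betw (restrict \<phi> ?V) ?V ?V"
    by (rule bij_betw_cong[THEN iffD1, rotated]) simp
  then have "restrict \<phi> ?V \<in> Bij ?V" unfolding Bij_def by blast
  moreover have "g \<in> ?V \<and> h \<in> ?V" if "(g, h) \<in> arcs (Cay_ball G T)" for g h
    using that by (auto simp: Cay_ball_def Cay_def)
  ultimately show ?thesis using step unfolding subgraph_colour_auts_def by auto
qed

text \<open>Re-based at any \<open>g\<close>, the automorphism fixes the identity and hence the
  generators. So it commutes with right multiplication by generators, and by induction with every
  right multiplication.\<close>

lemma orientation_rigid_pair_if_strongly:
  assumes S: "generating_set G S" and T: "T \<subseteq> carrier G" "S \<subseteq> T"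
    and strong: "strongly_orientation_rigid G S T"
  shows "orientation_rigid_pair G T"
  unfolding orientation_rigid_pair_iff[OF T(1)]
proof (intro ballI impI)
  fix \<phi> x assume phi: "\<phi> \<in> colour_auts G T" "\<phi> \<one> = \<one>" and x: "x \<in> carrier G"
  have SC: "S \<subseteq> carrier G" "generate G S = carrier G" using S by (auto simp: generating_set_def)
  have ST: "symm G S \<subseteq> symm G T" using T by (auto simp: symm_def SET_INV_def)
  have pc: "\<phi> x \<in> carrier G" if "x \<in> carrier G" for x
    using phi(1) Bij_imp_funcset that by (auto simp: colour_auts_def)
  have base: "\<psi> s = s" if psi: "\<psi> \<in> colour_auts G T" "\<psi> \<one> = \<one>" and s: "s \<in> symm G S" for \<psi> s
  proof -
    let ?r = "restrict \<psi> (verts (Cay_ball G T))"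
    have "?r \<one> = \<one>" using psi by (simp add: verts_Cay_ball)
    then have "?r s = s"
      using strong restrict_colour_aut[OF T(1) psi] s
      unfolding strongly_orientation_rigid_def verts_Cay_ball[of S] by blast
    then show ?thesis using s ST by (auto simp: verts_Cay_ball)
  qed
  have step: "\<phi> (g \<otimes> s) = \<phi> g \<otimes> s" if g: "g \<in> carrier G" and s: "s \<in> symm G S" for g s
  proof -
    define \<psi> where "\<psi> = (\<lambda>x \<in> carrier G. inv (\<phi> g) \<otimes> \<phi> (g \<otimes> x))"
    have "\<psi> \<in> colour_auts G T" unfolding \<psi>_def using colour_auts_translate T phi g pc by simp
    moreover have "\<psi> \<one> = \<one>" using g pc by (simp add: \<psi>_def)
    ultimately have "\<psi> s = s" using base s by blast
    moreover have sc: "s \<in> carrier G" using s symm_carrier[OF SC(1)] by blast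
    ultimately have "inv (\<phi> g) \<otimes> \<phi> (g \<otimes> s) = s" by (simp add: \<psi>_def)
    then show ?thesis using g sc pc inv_solve_left'[of s "\<phi> g" "\<phi> (g \<otimes> s)"] by simp
  qed
  have "\<forall>g \<in> carrier G. \<phi> (g \<otimes> h) = \<phi> g \<otimes> h" if "h \<in> generate G S" for h
    using that
  proof (induction rule: generate.induct)
    case one then show ?case using pc by simp
  next
    case (incl h) then show ?case using step by (simp add: symm_def)
  next
    case (inv h) then show ?case using step by (auto simp: symm_def SET_INV_def)
  next
    case (eng h k)
    then have "h \<in> carrier G" "k \<in> carrier G" using generate_in_carrier SC(1) by blast+
    then show ?case using eng.IH pc by (simp flip: m_assoc)
  qed
  then have "\<phi> (\<one> \<otimes> x) = \<phi> \<one> \<otimes> x" using x SC by blast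
  then show "\<phi> x = x" using x phi by simp
qed

section \<open>Maps that refute rigidity for every set of colours\<close>

lemma not_rigid_if_involution:
  assumes T: "T \<subseteq> carrier G"
    and f: "\<And>g. g \<in> carrier G \<Longrightarrow> f g \<in> carrier G" "\<And>g. g \<in> carrier G \<Longrightarrow> f (f g) = g"
      "\<And>g h. \<lbrakk>g \<in> carrier G; h \<in> carrier G\<rbrakk> \<Longrightarrow> f (g \<otimes> h) = f g \<otimes> h \<or> f (g \<otimes> h) = f g \<otimes> inv h"
      "f \<one> = \<one>"
    and x: "x \<in> carrier G" "f x \<noteq> x"
  shows "\<not> orientation_rigid_pair G T"
proof -
  have "bij_betw (restrict f (carrier G)) (carrier G) (carrier G)"
    using f by (intro bij_betw_byWitness[where f' = f]) auto
  then have "restrict f (carrier G) \<in> colour_auts G T"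
    using f(3) symm_carrier[OF T] unfolding colour_auts_def Bij_def by (auto simp: subset_iff)
  then show ?thesis using f(4) x unfolding orientation_rigid_pair_iff[OF T] by force
qed

lemma not_rigid_if_abelian:
  assumes "comm_group G" "x \<in> carrier G" "order_gt_2 G x" "T \<subseteq> carrier G"
  shows "\<not> orientation_rigid_pair G T"
proof (rule not_rigid_if_involution[OF assms(4), of "\<lambda>g. inv g" x])
  show "inv (g \<otimes> h) = inv g \<otimes> h \<or> inv (g \<otimes> h) = inv g \<otimes> inv h" if "g \<in> carrier G" "h \<in> carrier G" for g h
    using that comm_group.inv_mult[OF assms(1)] by simp
  show "inv x \<noteq> x" using assms order_gt_2_iff square_one_iff by simp
qed (use assms in auto)

text \<open>The colour condition rests on three properties of the elements outside \<open>A\<close>: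
  they invert \<open>A\<close>, they all have the square of \<open>x\<close>, and the product of two
  of them lies in \<open>A\<close>.\<close>

lemma not_rigid_if_generalized_dicyclic:
  assumes "generalized_dicyclic G" "T \<subseteq> carrier G"
  shows "\<not> orientation_rigid_pair G T"
proof -
  obtain A x where A: "A \<lhd> G" "comm_group (G\<lparr>carrier := A\<rparr>)" "card (rcosets A) = 2"
    and x: "x \<in> carrier G" "x \<notin> A" "ord x = 4" "\<And>a. a \<in> A \<Longrightarrow> x \<otimes> a \<otimes> inv x = inv a"
    using assms(1) unfolding generalized_dicyclic_def by blast
  interpret A: normal A G by (rule A(1))
  have sub: "subgroup A G" by (rule A.subgroup_axioms)
  note [simp] = A.mem_carrier
  have comm: "a \<otimes> b = b \<otimes> a" if "a \<in> A" "b \<in> A" for a b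
    using comm_groupE(4)[OF A(2)] that by simp
  have x4: "(x \<otimes> x) \<otimes> (x \<otimes> x) = \<one>"
    using pow_ord_eq_1[OF x(1)] x(1) unfolding x(3) by (simp add: numeral_eq_Suc m_assoc)
  have inv_x: "x \<otimes> a = inv a \<otimes> x" if "a \<in> A" for a
  proof -
    have "x \<otimes> a \<otimes> inv x \<otimes> x = inv a \<otimes> x" using x(4)[OF that] by simp
    then show ?thesis using that x(1) by (simp add: m_assoc)
  qed
  have "A \<in> rcosets A" "A #> x \<in> rcosets A"
    using rcosetsI[OF A.subset x(1)] rcosetsI[OF A.subset one_closed] A.subset by (simp_all add: coset_mult_one)
  moreover have "A \<noteq> A #> x" using coset_join1[of A x] sub x by auto
  ultimately have cosets: "rcosets A = {A, A #> x}"
    using A(3) by (metis (no_types, lifting) card_2_iff doubleton_eq_iff insertE singletonD)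
  have dec: "\<exists>a \<in> A. g = a \<otimes> x" if "g \<in> carrier G" "g \<notin> A" for g
  proof -
    have "A #> g \<in> {A, A #> x}" using rcosetsI[OF A.subset that(1)] cosets by simp
    moreover have "A #> g \<noteq> A" using coset_join1[of A g] sub that by auto
    ultimately have "g \<in> A #> x" using rcos_self[OF that(1) sub] by auto
    then show ?thesis by (auto simp: r_coset_def)
  qed
  have xx: "x \<otimes> x \<in> A"
  proof (rule ccontr)
    assume "x \<otimes> x \<notin> A"
    then obtain a where "a \<in> A" "x \<otimes> x = a \<otimes> x" using dec x(1) by blast
    then show False using x by simp
  qed
  have inverts: "g \<otimes> b = inv b \<otimes> g" if asm: "g \<in> carrier G" "g \<notin> A" "b \<in> A" for g b
  proof -
    obtain a where a: "a \<in> A" "g = a \<otimes> x" using dec[OF asm(1,2)] by blast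
    have "g \<otimes> b = a \<otimes> inv b \<otimes> x" using a inv_x[OF asm(3)] asm x(1) by (simp add: m_assoc)
    also have "a \<otimes> inv b = inv b \<otimes> a" using comm a asm by simp
    finally show ?thesis using a asm x(1) by (simp add: m_assoc)
  qed
  have square: "g \<otimes> g = x \<otimes> x" if asm: "g \<in> carrier G" "g \<notin> A" for g
  proof -
    obtain a where a: "a \<in> A" "g = a \<otimes> x" using dec[OF asm(1,2)] by blast
    \<comment> \<open>\<open>g\<close> inverts its own component \<open>a\<close>; multiplied by
      \<open>x\<close>, this turns the square of \<open>g\<close> into that of
      \<open>x\<close>.\<close>
    have "g \<otimes> a = inv a \<otimes> g" using inverts asm a by blast
    then have "g \<otimes> a \<otimes> x = inv a \<otimes> g \<otimes> x" by simp
    then show ?thesis using a x(1) by (simp add: m_assoc)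
  qed
  have outer: "g \<otimes> h \<in> A" if asm: "g \<in> carrier G" "g \<notin> A" "h \<in> carrier G" "h \<notin> A" for g h
  proof -
    obtain a b where a: "a \<in> A" "g = a \<otimes> x" and b: "b \<in> A" "h = b \<otimes> x"
      using dec[OF asm(1,2)] dec[OF asm(3,4)] by blast
    have "g \<otimes> h = a \<otimes> (x \<otimes> b) \<otimes> x" using a b x(1) by (simp add: m_assoc)
    also have "\<dots> = a \<otimes> inv b \<otimes> (x \<otimes> x)" using inv_x[OF b(1)] a b x(1) by (simp add: m_assoc)
    finally show ?thesis using a b xx by simp
  qed
  have mem: "g \<otimes> h \<in> A \<longleftrightarrow> h \<in> A" "h \<otimes> g \<in> A \<longleftrightarrow> h \<in> A" if "g \<in> A" "h \<in> carrier G" for g h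
  proof -
    have "h \<in> A" if "g \<otimes> h \<in> A"
    proof -
      have "inv g \<otimes> (g \<otimes> h) \<in> A" using that \<open>g \<in> A\<close> by blast
      then show ?thesis using \<open>g \<in> A\<close> \<open>h \<in> carrier G\<close> by simp
    qed
    then show "g \<otimes> h \<in> A \<longleftrightarrow> h \<in> A" using that by blast
    have "h \<in> A" if "h \<otimes> g \<in> A"
    proof -
      have "h \<otimes> g \<otimes> inv g \<in> A" using that \<open>g \<in> A\<close> by blast
      then show ?thesis using \<open>g \<in> A\<close> \<open>h \<in> carrier G\<close> by (simp add: m_assoc)
    qed
    then show "h \<otimes> g \<in> A \<longleftrightarrow> h \<in> A" using that by blast
  qed
  have minv: "inv g \<in> A \<longleftrightarrow> g \<in> A" if "g \<in> carrier G" for g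
    using that A.m_inv_closed inv_inv by metis
  define f where "f g = (if g \<in> A then g else inv g)" for g
  show ?thesis
  proof (rule not_rigid_if_involution[OF assms(2), of f x])
    fix g h assume g: "g \<in> carrier G" and h: "h \<in> carrier G"
    consider "g \<in> A" "h \<in> A" | "g \<in> A" "h \<notin> A" | "g \<notin> A" "h \<in> A" | "g \<notin> A" "h \<notin> A" by blast
    then show "f (g \<otimes> h) = f g \<otimes> h \<or> f (g \<otimes> h) = f g \<otimes> inv h"
    proof cases
      case 1
      then show ?thesis by (simp add: f_def)
    next
      case 2
      have "inv h \<otimes> inv g = g \<otimes> inv h" using inverts[of "inv h" "inv g"] 2 g h minv by simp
      then show ?thesis using 2 g h mem by (simp add: f_def inv_mult_group)
    next
      case 3
      have "inv g \<otimes> h = inv h \<otimes> inv g" using inverts[of "inv g" h] 3 g h minv by simp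
      then show ?thesis using 3 g h mem by (simp add: f_def inv_mult_group)
    next
      case 4
      \<comment> \<open>Here the order 4 of \<open>x\<close> enters: the two equal squares cancel,
        so \<open>g \<otimes> h\<close> equals \<open>inv g \<otimes> inv h\<close>.\<close>
      have "(g \<otimes> g) \<otimes> (h \<otimes> h) = \<one>" using square 4 g h x4 by simp
      then have "inv g \<otimes> ((g \<otimes> g) \<otimes> (h \<otimes> h)) \<otimes> inv h = inv g \<otimes> inv h" using g h by simp
      then have "g \<otimes> h = inv g \<otimes> inv h" using g h by (simp add: m_assoc)
      moreover have "f (g \<otimes> h) = g \<otimes> h" "f g = inv g" using 4 g h outer by (simp_all add: f_def)
      ultimately show ?thesis by metis
    qed
  next
    have "x \<otimes> x \<noteq> \<one>"
      using order_gt_2_iff[OF x(1)] x(3) by (simp add: order_gt_2_def)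
    then show "f x \<noteq> x" using x square_one_iff by (simp add: f_def)
  qed (use x minv in \<open>auto simp: f_def\<close>)
qed

section \<open>The implications between the six conditions\<close>

lemma strongly_orientation_rigid_if_not_exceptional:
  assumes nd: "\<not> generalized_dicyclic G" and nc: "\<not> (comm_group G \<and> (\<exists>x \<in> carrier G. order_gt_2 G x))"
    and S: "generating_set G S"
  shows "strongly_orientation_rigid G S (products_upto G 3 S)"
  unfolding strongly_orientation_rigid_def
proof (intro ballI impI)
  fix \<phi> x
  assume phi: "\<phi> \<in> subgraph_colour_auts G (products_upto G 3 S) (Cay_ball G (products_upto G 3 S))"
    "\<phi> \<one> = \<one>" and x: "x \<in> verts (Cay_ball G S)"
  have SC: "S \<subseteq> carrier G" "generate G S = carrier G" using S by (auto simp: generating_set_def)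
  interpret ball_automorphism G S \<phi> by (rule ball_automorphismI[OF SC(1) phi])
  show "\<phi> x = x"
  proof (rule ccontr)
    assume "\<phi> x \<noteq> x"
    then have xM: "x \<in> M" using x phi by (auto simp: verts_Cay_ball)
    then have fx: "flipped x" using \<open>\<phi> x \<noteq> x\<close> by (simp add: flipped_def)
    \<comment> \<open>A moved vertex is not its own inverse, which excludes the abelian case; it
      then serves as the moved generator \<open>f0\<close>.\<close>
    then have "order_gt_2 G x" using flippedD(2,4) order_gt_2_iff by blast
    then have ncomm: "\<not> comm_group G" using nc xM by auto
    interpret moving_ball_automorphism G S \<phi> x
      by unfold_locales (use SC xM fx ncomm in auto)
    show False using generalized_dicyclic nd by blast
  qed
qed

lemma not_exceptional_if_rigid:
  assumes "orientation_rigid_pair G T" "T \<subseteq> carrier G"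
  shows "\<not> generalized_dicyclic G \<and> \<not> (comm_group G \<and> (\<exists>x \<in> carrier G. order_gt_2 G x))"
  using assms not_rigid_if_abelian not_rigid_if_generalized_dicyclic by blast

text \<open>Makes condition (2) the instance of the rigidity of \<open>products_upto G 3 S\<close>
  in which \<open>S\<close> consists of all non-trivial elements.\<close>

lemma products_upto_nontrivial:
  assumes "1 \<le> n"
  shows "products_upto G n (carrier G - {\<one>}) = carrier G - {\<one>}"
  using generating_set_products_upto[OF generating_set_nontrivial assms]
  by (auto simp: generating_set_def)

end

theorem theorem6:
  fixes G :: "('a, 'b) monoid_scheme"
  assumes "group G"
  shows
    "let c1 = \<not> generalized_dicyclic G \<and>
               \<not> (comm_group G \<and> (\<exists>x \<in> carrier G. order_gt_2 G x));
         c2 = orientation_rigid G;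
         c3 = (\<forall>S. generating_set G S \<longrightarrow>
                 orientation_rigid_pair G (products_upto G 3 S));
         c3' = (\<exists>S. generating_set G S \<and>
                 orientation_rigid_pair G (products_upto G 3 S));
         c4 = (\<forall>S. generating_set G S \<longrightarrow>
                 strongly_orientation_rigid G S (products_upto G 3 S));
         c4' = (\<exists>S. generating_set G S \<and>
                 strongly_orientation_rigid G S (products_upto G 3 S))
     in (c1 \<longleftrightarrow> c2) \<and> (c1 \<longleftrightarrow> c3) \<and> (c1 \<longleftrightarrow> c3') \<and> (c1 \<longleftrightarrow> c4) \<and> (c1 \<longleftrightarrow> c4')"
proof -
  interpret group G by (rule assms)
  let ?c1 = "\<not> generalized_dicyclic G \<and> \<not> (comm_group G \<and> (\<exists>x \<in> carrier G. order_gt_2 G x))"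
  let ?N = "carrier G - {\<one>\<^bsub>G\<^esub>}"
  have T: "S \<subseteq> products_upto G 3 S" "products_upto G 3 S \<subseteq> carrier G" if "generating_set G S" for S
    using generating_set_products_upto[OF that, of 3] by (auto simp: generating_set_def)
  have strong: "strongly_orientation_rigid G S (products_upto G 3 S)" if ?c1 "generating_set G S" for S
    using strongly_orientation_rigid_if_not_exceptional that by blast
  have rigid: "orientation_rigid_pair G (products_upto G 3 S)"
    if "strongly_orientation_rigid G S (products_upto G 3 S)" "generating_set G S" for S
    using orientation_rigid_pair_if_strongly that T by blast
  have c1: ?c1 if "orientation_rigid_pair G (products_upto G 3 S)" "generating_set G S" for S
    using not_exceptional_if_rigid[OF that(1) T(2)[OF that(2)]] .
  have N: "generating_set G ?N" by (rule generating_set_nontrivial)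
  have "orientation_rigid G \<longleftrightarrow> orientation_rigid_pair G (products_upto G 3 ?N)"
    by (simp add: orientation_rigid_def products_upto_nontrivial)
  then have "?c1 \<longleftrightarrow> orientation_rigid G" using strong rigid c1 N by blast
  moreover have "?c1 \<longleftrightarrow> (\<forall>S. generating_set G S \<longrightarrow> orientation_rigid_pair G (products_upto G 3 S))"
    using strong rigid c1 N by blast
  moreover have "?c1 \<longleftrightarrow> (\<exists>S. generating_set G S \<and> orientation_rigid_pair G (products_upto G 3 S))"
    using strong rigid c1 N by blast
  moreover have "?c1 \<longleftrightarrow> (\<forall>S. generating_set G S \<longrightarrow>
      strongly_orientation_rigid G S (products_upto G 3 S))"
    using strong rigid c1 N by blast
  moreover have "?c1 \<longleftrightarrow> (\<exists>S. generating_set G S \<and>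
      strongly_orientation_rigid G S (products_upto G 3 S))"
    using strong rigid c1 N by blast
  ultimately show ?thesis unfolding Let_def by blast
qed

end
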